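(* Let $(c_n)_{n\in\mathbb N}$ be a sequence of non-negative real numbers with $\sum_{n\in\mathbb N}c_n=1$, let $(\vartheta_n)_{n\in\mathbb N}$ be independent random variables, each uniformly distributed on $[0,2\pi)$, and put $\zeta_n=e^{i\vartheta_n}$. Let $\mu=\sum_{n\in\mathbb N}c_n\delta_{\zeta_n}$ and let $\varphi$ be the associated random inner function $$\varphi(z)=\frac{H\mu(z)-1}{H\mu(z)+1},\qquad H\mu(z)=\int_{\mathbb T}\frac{\zeta+z}{\zeta-z}\,d\mu(\zeta),\qquad z\in\mathbb D.$$ Let $\Lambda=(\lambda_k)_{k}$ be the sequence of zeros of $\varphi$ and let $1/2\le\alpha<1$. If $(c_n)_{n\in\mathbb N}\in\ell^\alpha$, i.e. $\sum_n c_n^\alpha<\infty$, then for every $\varepsilon>0$, $$\sum_{k}(1-|\lambda_k|)^{\alpha+\varepsilon}<\infty\quad\text{almost surely.}$$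
   Context: $\mathbb D$ is the open unit disk in $\mathbb C$, $\mathbb T=\partial\mathbb D$. An inner function is an analytic map $\mathbb D\to\mathbb D$ with radial limits of modulus $1$ at Lebesgue-almost every point of $\mathbb T$; the random function $\varphi$ in the claim is inner. Zeros in $\mathbb D$ are listed with multiplicity. *)

theory Defs
  imports "HOL-Probability.Probability" "HOL-Complex_Analysis.Complex_Analysis"
begin

definition atomic_measure :: "(nat \<Rightarrow> real) \<Rightarrow> (nat \<Rightarrow> complex) \<Rightarrow> complex measure" where
  "atomic_measure c \<zeta> = measure_of UNIV (sets borel)
     (\<lambda>A. \<Sum>n. ennreal (c n) * emeasure (return borel (\<zeta> n)) A)"

definition herglotz :: "complex measure \<Rightarrow> complex \<Rightarrow> complex" where
  "herglotz \<mu> z = (LINT \<zeta>:sphere 0 1|\<mu>. (\<zeta> + z) / (\<zeta> - z))"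

definition inner_of_measure :: "complex measure \<Rightarrow> complex \<Rightarrow> complex" where
  "inner_of_measure \<mu> z = (herglotz \<mu> z - 1) / (herglotz \<mu> z + 1)"

text \<open>Listing with multiplicity: a zero \<open>w\<close> of multiplicity \<open>m\<close> contributes the indices
  \<open>(w, 0), \<dots>, (w, m - 1)\<close>, so the sequence of zeros is \<open>fst\<close> on this
  index set.\<close>

definition disk_zeros :: "(complex \<Rightarrow> complex) \<Rightarrow> (complex \<times> nat) set" where
  "disk_zeros f = (SIGMA w:{w \<in> ball 0 1. f w = 0}. {..<nat (zorder f w)})"

text \<open>The set function in \<open>atomic_measure\<close> is a measure, so \<open>measure_of\<close> does not
  fall back to the zero measure.\<close>

lemma emeasure_atomic_measure:
  assumes "A \<in> sets borel"
  shows "emeasure (atomic_measure c \<zeta>) A =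
    (\<Sum>n. ennreal (c n) * emeasure (return borel (\<zeta> n)) A)"
proof -
  let ?N = "distr (density (count_space UNIV) (\<lambda>n. ennreal (c n))) borel \<zeta>"
  have N: "emeasure ?N B = (\<Sum>n. ennreal (c n) * emeasure (return borel (\<zeta> n)) B)"
    if "B \<in> sets borel" for B
  proof -
    have "emeasure ?N B = (\<integral>\<^sup>+ n. ennreal (c n) * indicator (\<zeta> -` B) n \<partial>count_space UNIV)"
      using that by (simp add: emeasure_distr emeasure_density)
    also have "\<dots> = (\<Sum>n. ennreal (c n) * indicator (\<zeta> -` B) n)"
      by (rule nn_integral_count_space_nat)
    finally show ?thesis
      using that by (simp add: indicator_vimage)
  qed
  have "?N = measure_of UNIV (sets borel) (emeasure ?N)"
    using measure_of_of_measure[of ?N] by simp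
  also have "\<dots> = atomic_measure c \<zeta>"
    unfolding atomic_measure_def using sets.sigma_sets_eq[of "borel :: complex measure"]
    by (intro measure_of_eq) (auto simp: N)
  finally show ?thesis
    using N[OF assms] by simp
qed

end

theory Submission
  imports Defs
begin

text \<open>
  Write \<open>H\<close> for the Herglotz transform. A zero of \<open>\<phi> = (H - 1) / (H + 1)\<close> is a point where
  \<open>H = 1\<close>, and the identity
  \<open>1 / \<bar>\<phi>\<bar>\<^sup>2 = 1 + 4 * Re H / \<bar>H - 1\<bar>\<^sup>2\<close>
  says that \<open>\<bar>\<phi>\<bar>\<close> is close to \<open>1\<close> wherever the Poisson integral \<open>Re H\<close> is small. For an
  atomic measure this is the typical behaviour near the circle: although \<open>Re H\<close> has mean \<open>1\<close>, its
  \<open>p\<close>-th moment at distance \<open>\<delta>\<close> from the circle is at most of order \<open>\<delta> powr (1 - p)\<close> when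
  \<open>1 / 2 < p \<le> 1\<close> and the \<open>p\<close>-th powers of the weights are summable (\<open>Re_H_powr_moment\<close>).

  Zeros are counted through values of \<open>\<phi>\<close> at the points of a grid that has about \<open>1 / \<delta>\<close> points at each
  of a geometric sequence of distances \<open>\<delta>\<close> from the circle. By Jensen's inequality
  (\<open>zero_count_le\<close>), the number of zeros in the disc of radius \<open>\<delta> / 4\<close> around a grid point \<open>a\<close>
  is at most a multiple of \<open>ln (1 / \<bar>\<phi> a\<bar>)\<close>, and this is at most
  \<open>16 * (1 + ln (1 / \<delta>)) * Re (H a) powr p\<close>, provided that \<open>H a\<close> is not within
  \<open>\<delta> ^ 4\<close> of \<open>1\<close> (\<open>ln_deficit_le\<close>).

  That proviso holds almost surely at all but finitely many grid points. Indeed, conditionally on all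
  other angles, a single uniform angle already makes the probability of \<open>\<bar>H a - 1\<bar> \<le> t\<close> at most a
  constant multiple of \<open>t\<close>, with a constant independent of the grid point \<open>a\<close> (\<open>prob_H_near_1\<close>), and the
  Borel-Cantelli lemma applies. What is left is a sum over the grid whose expectation is finite: for
  the exponent \<open>s = \<alpha> + \<epsilon>\<close> and any \<open>p\<close> with \<open>\<alpha> < p < s\<close>, the points at distance \<open>\<delta>\<close>
  contribute, up to a logarithm, \<open>(1 / \<delta>) * \<delta> powr s * \<delta> powr (1 - p) = \<delta> powr (s - p)\<close>.
\<close>

section \<open>Zeros of bounded holomorphic functions\<close>

lemma zorder_linear_power: "zorder (\<lambda>z. (z - x) ^ n) w = (if w = x then int n else 0)"
proof (cases "w = x")
  case True
  then show ?thesis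
    using zorder_eqI[of UNIV w "\<lambda>_. 1" "\<lambda>z. (z - x) ^ n" "int n"] by simp
next
  case False
  then show ?thesis
    by (auto intro!: zorder_eq_0I analytic_intros)
qed

text \<open>The product on the right has the same zeros as \<open>f\<close>, to the same orders, so the two functions
differ by a holomorphic factor. The orders are cut off at \<open>0\<close> by \<open>nat\<close>, which changes nothing at
a zero of a function that does not vanish identically near it: there the order is positive.\<close>

lemma holomorphic_factor_all_zeros:
  fixes f :: "complex \<Rightarrow> complex"
  assumes hol: "f holomorphic_on S" and S: "open S" "connected S"
    and fin: "finite {w \<in> S. f w = 0}" and nz: "\<xi> \<in> S" "f \<xi> \<noteq> 0"
  obtains h where "h holomorphic_on S"
    "\<And>z. z \<in> S \<Longrightarrow> f z = h z * (\<Prod>w\<in>{w \<in> S. f w = 0}. (z - w) ^ nat (zorder f w))"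
proof -
  define Z where "Z = {w \<in> S. f w = 0}"
  define P where "P = (\<lambda>z. \<Prod>w\<in>Z. (z - w) ^ nat (zorder f w))"
  have ana: "f analytic_on {z}" if "z \<in> S" for z
    using analytic_at hol S that by blast
  have freq: "frequently (\<lambda>w. f w \<noteq> 0) (at z)" if "z \<in> S" for z
  proof -
    have "eventually (\<lambda>w. f w \<noteq> 0 \<and> w \<in> S) (at z)"
      by (rule non_zero_neighbour_alt[where ?\<beta> = \<xi>]) (use assms that in auto)
    then show ?thesis
      by (intro eventually_frequently) (auto elim: eventually_mono)
  qed
  have finZ: "finite Z"
    using fin unfolding Z_def .
  have ord_pos: "zorder f w > 0" if "w \<in> Z" for w
    using zorder_pos_iff'[OF ana freq, of w] that by (auto simp: Z_def)
  have P0: "P z = 0 \<longleftrightarrow> z \<in> Z" for z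
    using finZ ord_pos by (auto simp: P_def)
  have ev: "eventually (\<lambda>z. P z \<noteq> 0) (at z)" for z
    unfolding P0 using finZ by (simp add: finite_imp_closed eventually_at_topological)
       (metis (no_types, lifting) ComplI Compl_iff Diff_iff finite_Diff finite_imp_closed open_Compl singletonI insert_iff)
  have "zorder P z = zorder f z" if "z \<in> S" for z
  proof -
    have "zorder P z = (\<Sum>x\<in>Z. zorder (\<lambda>z. (z - x) ^ nat (zorder f x)) z)"
      unfolding P_def using ev[of z] by (intro zorder_prod_analytic analytic_intros) (auto simp: P_def)
    also have "\<dots> = (\<Sum>x\<in>Z. if z = x then int (nat (zorder f x)) else 0)"
      by (simp add: zorder_linear_power)
    also have "\<dots> = (if z \<in> Z then int (nat (zorder f z)) else 0)"
      using finZ by simp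
    also have "\<dots> = zorder f z"
      using ord_pos[of z] zorder_eq_0_iff[OF ana freq, of z] that by (auto simp: Z_def)
    finally show ?thesis .
  qed
  moreover have "P holomorphic_on S"
    unfolding P_def by (intro holomorphic_intros)
  ultimately obtain h where "h holomorphic_on S" "\<And>z. z \<in> S \<Longrightarrow> f z = h z * P z"
    using holomorphic_zorder_factorization[OF hol S, of P] P0 by (metis (mono_tags, lifting) Z_def mem_Collect_eq)
  then show ?thesis
    using that unfolding P_def Z_def by blast
qed

text \<open>The indexing convention is the one of \<^const>\<open>disk_zeros\<close>, so that sums over this set and its
cardinality count zeros with multiplicity.\<close>

definition zeros_in :: "complex set \<Rightarrow> (complex \<Rightarrow> complex) \<Rightarrow> (complex \<times> nat) set" where
  "zeros_in K f = (SIGMA w:{w \<in> K. f w = 0}. {..<nat (zorder f w)})"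

lemma finite_zero_set:
  assumes hol: "f holomorphic_on S" "open S" "connected S" and nz: "\<xi> \<in> S" "f \<xi> \<noteq> 0"
    and K: "compact K" "K \<subseteq> S"
  shows "finite {w \<in> K. f w = 0}"
proof (cases "f constant_on S")
  case True
  then have "{w \<in> K. f w = 0} = {}"
    using nz K unfolding constant_on_def by auto
  then show ?thesis by (simp only: finite.emptyI)
next
  case False
  then show ?thesis
    by (rule holomorphic_compact_finite_zeros[OF hol K])
qed

lemma finite_zeros_in: "finite {w \<in> K. f w = 0} \<Longrightarrow> finite (zeros_in K f)"
  unfolding zeros_in_def by auto

lemma card_zeros_in:
  assumes "finite {w \<in> K. f w = 0}"
  shows "card (zeros_in K f) = (\<Sum>w\<in>{w \<in> K. f w = 0}. nat (zorder f w))"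
  using assms unfolding zeros_in_def by simp

text \<open>A form of Jensen's inequality that needs no integral of a logarithm. Divide \<open>f\<close> by the polynomial
\<open>P1\<close> whose zeros are those of \<open>f\<close> in the disc of radius \<open>r\<close>. On the circle of radius \<open>3 * r\<close> each
linear factor of \<open>P1\<close> has modulus at least \<open>2 * r\<close>, whereas at the centre it has modulus at most
\<open>r\<close>. By the maximum principle for the quotient, each zero therefore forces \<open>f a\<close> down by a
factor \<open>2\<close>.\<close>

lemma zero_count_le:
  fixes f :: "complex \<Rightarrow> complex"
  assumes hol: "f holomorphic_on ball a R" and r: "0 < r" "3 * r < R"
    and bd: "\<And>z. z \<in> ball a R \<Longrightarrow> norm (f z) \<le> 1" and nz: "f a \<noteq> 0"
  shows "finite (zeros_in (cball a r) f)"
    and "2 ^ card (zeros_in (cball a r) f) * norm (f a) \<le> 1"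
proof -
  \<comment> \<open>A slightly smaller disc, whose closure lies in the domain, contains only finitely many zeros.\<close>
  define R' where "R' = (3 * r + R) / 2"
  have R': "3 * r < R'" "R' < R"
    using r by (auto simp: R'_def)
  have aR: "a \<in> ball a R"
    using r by simp
  define Z where "Z = {w \<in> ball a R'. f w = 0}"
  define Z1 where "Z1 = {w \<in> cball a r. f w = 0}"
  have "finite {z \<in> cball a R'. f z = 0}"
    by (rule finite_zero_set[OF hol open_ball connected_ball aR nz]) (use R' in auto)
  then have finZ: "finite Z"
    by (rule finite_subset[rotated]) (auto simp: Z_def)
  have Z1: "Z1 \<subseteq> Z"
    using r R' by (auto simp: Z_def Z1_def)
  then have finZ1: "finite Z1"
    using finZ finite_subset by blast
  then show "finite (zeros_in (cball a r) f)"
    unfolding Z1_def by (rule finite_zeros_in)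
  have hol': "f holomorphic_on ball a R'"
    using hol R' by (auto intro: holomorphic_on_subset)
  obtain h where h: "h holomorphic_on ball a R'"
    "\<And>z. z \<in> ball a R' \<Longrightarrow> f z = h z * (\<Prod>w\<in>Z. (z - w) ^ nat (zorder f w))"
    using holomorphic_factor_all_zeros[OF hol' open_ball connected_ball, of a] finZ nz r R'
    unfolding Z_def by auto
  define P1 where "P1 = (\<lambda>z. \<Prod>w\<in>Z1. (z - w) ^ nat (zorder f w))"
  define g where "g = (\<lambda>z. h z * (\<Prod>w\<in>Z - Z1. (z - w) ^ nat (zorder f w)))"
  have f: "f z = g z * P1 z" if "z \<in> ball a R'" for z
    using h(2)[OF that] prod.subset_diff[OF Z1 finZ, of "\<lambda>w. (z - w) ^ nat (zorder f w)"]
    by (simp add: g_def P1_def)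
  define N where "N = card (zeros_in (cball a r) f)"
  have N: "N = (\<Sum>w\<in>Z1. nat (zorder f w))"
    unfolding N_def using card_zeros_in finZ1 by (simp add: Z1_def)
  have g_hol: "g holomorphic_on ball a R'"
    unfolding g_def by (intro holomorphic_intros h)
  have "norm (g a) \<le> 1 / (2 * r) ^ N"
  proof (rule maximum_modulus_frontier[where f = g and S = "cball a (3 * r)"])
    show "g holomorphic_on interior (cball a (3 * r))"
      by (rule holomorphic_on_subset[OF g_hol]) (use R' in auto)
    show "continuous_on (closure (cball a (3 * r))) g"
      by (rule continuous_on_subset[OF holomorphic_on_imp_continuous_on[OF g_hol]])
        (use R' in auto)
    fix z assume "z \<in> frontier (cball a (3 * r))"
    then have z: "dist a z = 3 * r"
      using r by (simp add: frontier_cball)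
    have "(2 * r) ^ N = (\<Prod>w\<in>Z1. (2 * r) ^ nat (zorder f w))"
      unfolding N by (rule power_sum)
    also have "\<dots> \<le> (\<Prod>w\<in>Z1. norm (z - w) ^ nat (zorder f w))"
    proof (intro prod_mono conjI power_mono)
      fix w assume "w \<in> Z1"
      then have "dist a w \<le> r"
        by (simp add: Z1_def)
      then show "2 * r \<le> norm (z - w)"
        using z dist_triangle[of a z w] by (simp add: dist_norm norm_minus_commute)
    qed (use r in auto)
    also have "\<dots> = norm (P1 z)"
      by (simp add: P1_def norm_power flip: prod_norm)
    finally have P1: "(2 * r) ^ N \<le> norm (P1 z)" .
    have "norm (g z) * (2 * r) ^ N \<le> norm (g z) * norm (P1 z)"
      using P1 by (intro mult_left_mono) auto
    also have "\<dots> = norm (f z)"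
      using f[of z] z R' by (simp add: norm_mult)
    also have "\<dots> \<le> 1"
      using bd z R' by simp
    finally show "norm (g z) \<le> 1 / (2 * r) ^ N"
      using r by (simp add: field_simps)
  qed (use r in auto)
  moreover have "norm (P1 a) \<le> r ^ N"
  proof -
    have "norm (P1 a) = (\<Prod>w\<in>Z1. norm (a - w) ^ nat (zorder f w))"
      by (simp add: P1_def norm_power flip: prod_norm)
    also have "\<dots> \<le> (\<Prod>w\<in>Z1. r ^ nat (zorder f w))"
      by (intro prod_mono conjI power_mono) (auto simp: Z1_def dist_norm)
    also have "\<dots> = r ^ N"
      unfolding N by (rule power_sum[symmetric])
    finally show ?thesis .
  qed
  ultimately have "norm (g a) * norm (P1 a) \<le> 1 / (2 * r) ^ N * r ^ N"
    using r by (intro mult_mono) auto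
  also have "\<dots> = 1 / 2 ^ N"
    using r by (simp add: power_mult_distrib)
  finally show "2 ^ card (zeros_in (cball a r) f) * norm (f a) \<le> 1"
    using f[of a] r R' by (simp add: norm_mult N_def field_simps)
qed

section \<open>Subadditivity of powers\<close>

lemma power_powr:
  fixes x p :: real
  assumes "0 < x"
  shows "(x ^ n) powr p = (x powr p) ^ n"
  using assms by (induction n) (simp_all add: powr_mult)

lemma powr_add_le_add_powr:
  fixes x y p :: real
  assumes "0 \<le> x" "0 \<le> y" "0 < p" "p \<le> 1"
  shows "(x + y) powr p \<le> x powr p + y powr p"
proof (cases "x + y = 0")
  case False
  define s where "s = x + y"
  have s: "s > 0" using False assms by (simp add: s_def)
  have *: "t / s * s powr p \<le> t powr p" if "0 \<le> t" "t \<le> s" for t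
  proof -
    have "t / s \<le> (t / s) powr p"
      using powr_mono'[of p 1 "t / s"] assms that s by simp
    then have "t / s * s powr p \<le> (t / s) powr p * s powr p"
      by (intro mult_right_mono) auto
    also have "\<dots> = t powr p"
      using that s by (simp flip: powr_mult)
    finally show ?thesis .
  qed
  have "s powr p = x / s * s powr p + y / s * s powr p"
    using s by (simp add: s_def flip: distrib_right add_divide_distrib)
  also have "\<dots> \<le> x powr p + y powr p"
    using *[of x] *[of y] assms by (simp add: s_def add_mono)
  finally show ?thesis by (simp add: s_def)
qed (use assms in auto)

lemma powr_suminf_le:
  fixes x :: "nat \<Rightarrow> real"
  assumes "\<And>n. 0 \<le> x n" "0 < p" "p \<le> 1" "summable x" "summable (\<lambda>n. x n powr p)"
  shows "(\<Sum>n. x n) powr p \<le> (\<Sum>n. x n powr p)"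
proof (rule LIMSEQ_le)
  show "(\<lambda>n. (\<Sum>i<n. x i) powr p) \<longlonglongrightarrow> (\<Sum>n. x n) powr p"
    using assms by (intro tendsto_powr' summable_LIMSEQ tendsto_const) (auto simp: sum_nonneg)
  show "(\<lambda>n. \<Sum>i<n. x i powr p) \<longlonglongrightarrow> (\<Sum>n. x n powr p)"
    by (rule summable_LIMSEQ) fact
  have "(\<Sum>i<n. x i) powr p \<le> (\<Sum>i<n. x i powr p)" for n
  proof (induction n)
    case (Suc n)
    have "(\<Sum>i<Suc n. x i) powr p \<le> (\<Sum>i<n. x i) powr p + x n powr p"
      using powr_add_le_add_powr[of "\<Sum>i<n. x i" "x n" p] assms by (simp add: sum_nonneg)
    with Suc show ?case by simp
  qed simp
  then show "\<exists>N. \<forall>n\<ge>N. (\<Sum>i<n. x i) powr p \<le> (\<Sum>i<n. x i powr p)" by blast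
qed

section \<open>The Cayley transform of a point in the right half-plane\<close>

text \<open>The logarithm on the left is \<open>2 * ln (1 / \<bar>\<phi>\<bar>)\<close> for \<open>\<phi> = (H - 1) / (H + 1)\<close>, see
\<open>norm_Cayley\<close> below. If \<open>Re H\<close> is small, then \<open>H\<close> is far from \<open>1\<close> and the logarithm is
at most of the order of \<open>Re H\<close>. If \<open>Re H\<close> is not small, the power of \<open>Re H\<close> on the right is
bounded below, and only a polynomial lower bound on the distance of \<open>H\<close> from \<open>1\<close> is needed, at
the price of a logarithm of \<open>\<delta>\<close>.\<close>

lemma ln_deficit_le:
  fixes H :: complex and p \<delta> :: real
  assumes "0 < Re H" "0 < \<delta>" "\<delta> \<le> 1" "0 < p" "p \<le> 1" "\<delta> ^ 4 \<le> norm (H - 1)"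
  shows "ln (1 + 4 * Re H / (norm (H - 1))\<^sup>2) \<le> 16 * (1 + ln (1 / \<delta>)) * Re H powr p"
proof -
  define h d where "h = Re H" and "d = norm (H - 1)"
  have h: "h > 0" and d: "d \<ge> \<delta> ^ 4" using assms by (auto simp: h_def d_def)
  have d0: "d > 0" using d assms by (smt (verit) zero_less_power)
  have L: "ln (1 / \<delta>) \<ge> 0" using assms by (intro ln_ge_zero) auto
  have dh: "\<bar>h - 1\<bar> \<le> d"
    using abs_Re_le_cmod[of "H - 1"] by (simp add: h_def d_def)
  have "ln (1 + 4 * h / d\<^sup>2) \<le> 16 * (1 + ln (1 / \<delta>)) * h powr p"
  proof (cases "h \<le> 1 / 2")
    case True
    then have "(1 / 2)\<^sup>2 \<le> d\<^sup>2" using dh by (intro power_mono) auto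
    then have "4 * h / d\<^sup>2 \<le> 16 * h"
      using h d0 by (simp add: field_simps power2_eq_square mult_left_mono)
    moreover have "ln (1 + 4 * h / d\<^sup>2) \<le> 4 * h / d\<^sup>2"
      using h by (intro ln_add_one_self_le_self) auto
    moreover have "h \<le> h powr p"
      using powr_mono'[of p 1 h] h True assms by simp
    moreover have "h powr p * 1 \<le> h powr p * (1 + ln (1 / \<delta>))"
      using L by (intro mult_left_mono) auto
    ultimately show ?thesis by (simp add: algebra_simps)
  next
    case False
    have \<delta>8: "\<delta> ^ 8 \<le> d\<^sup>2" "\<delta> ^ 8 \<le> 1"
      using power_mono[OF d, of 2] assms by (auto simp: power_le_one simp flip: power_mult)
    have "4 * h / d\<^sup>2 \<le> 8 / \<delta> ^ 8"
    proof (cases "d \<le> 1")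
      case True
      then have "4 * h / d\<^sup>2 \<le> 8 / d\<^sup>2" using dh d0 by (intro divide_right_mono) auto
      also have "\<dots> \<le> 8 / \<delta> ^ 8" using \<delta>8 assms d0 by (intro divide_left_mono mult_pos_pos) auto
      finally show ?thesis .
    next
      case False
      have "4 * h / d\<^sup>2 \<le> 8 * d / d\<^sup>2" using dh d0 False by (intro divide_right_mono) auto
      also have "\<dots> \<le> 8" using False d0 by (simp add: power2_eq_square field_simps)
      also have "\<dots> \<le> 8 / \<delta> ^ 8" using \<delta>8 assms by (simp add: field_simps)
      finally show ?thesis .
    qed
    then have "1 + 4 * h / d\<^sup>2 \<le> 9 / \<delta> ^ 8"
      using \<delta>8 assms by (simp add: field_simps)
    then have "ln (1 + 4 * h / d\<^sup>2) \<le> ln (9 * (1 / \<delta>) ^ 8)"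
      using h d0 by (intro ln_mono) (auto simp: add_pos_nonneg power_one_over divide_simps)
    also have "\<dots> = ln 9 + 8 * ln (1 / \<delta>)"
      using assms by (subst ln_mult) (auto simp: ln_realpow)
    also have "\<dots> \<le> 8 * (1 + ln (1 / \<delta>)) * 1"
      using ln_le_minus_one[of 9] by simp
    also have "\<dots> \<le> 8 * (1 + ln (1 / \<delta>)) * (2 * h powr p)"
    proof (intro mult_left_mono)
      have "1 / 2 \<le> (1 / 2 :: real) powr p"
        using powr_mono'[of p 1 "1/2 :: real"] assms by simp
      also have "\<dots> \<le> h powr p" using False assms by (intro powr_mono2) auto
      finally show "1 \<le> 2 * h powr p" by simp
    qed (use L in auto)
    finally show ?thesis by (simp add: algebra_simps)
  qed
  then show ?thesis by (simp add: h_def d_def)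
qed

lemma norm_Cayley:
  fixes H :: complex
  assumes "0 < Re H"
  shows "norm ((H - 1) / (H + 1)) \<le> 1"
    and "H \<noteq> 1 \<Longrightarrow> 1 / (norm ((H - 1) / (H + 1)))\<^sup>2 = 1 + 4 * Re H / (norm (H - 1))\<^sup>2"
proof -
  have *: "(norm (H + 1))\<^sup>2 = (norm (H - 1))\<^sup>2 + 4 * Re H"
    unfolding cmod_power2 by (simp add: power2_eq_square algebra_simps)
  have "(norm (H - 1))\<^sup>2 \<le> (norm (H + 1))\<^sup>2"
    using * assms by simp
  then have "norm (H - 1) \<le> norm (H + 1)"
    by (rule power2_le_imp_le) simp
  moreover have "H + 1 \<noteq> 0"
    using assms by (auto simp: complex_eq_iff)
  ultimately show "norm ((H - 1) / (H + 1)) \<le> 1"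
    by (simp add: norm_divide)
  show "1 / (norm ((H - 1) / (H + 1)))\<^sup>2 = 1 + 4 * Re H / (norm (H - 1))\<^sup>2" if "H \<noteq> 1"
    using that * by (simp add: norm_divide power_divide add_divide_distrib)
qed

section \<open>The Herglotz transform of an atomic measure\<close>

lemma Herglotz_kernel_bound:
  fixes \<zeta> z :: complex
  assumes "norm \<zeta> = 1" "norm z < 1"
  shows "norm ((\<zeta> + z) / (\<zeta> - z)) \<le> 2 / (1 - norm z)"
    and "\<zeta> \<noteq> z"
proof -
  have "norm (\<zeta> + z) \<le> 2" using norm_triangle_ineq[of \<zeta> z] assms by simp
  moreover have "1 - norm z \<le> norm (\<zeta> - z)" using norm_triangle_ineq2[of \<zeta> z] assms by simp
  ultimately show "norm ((\<zeta> + z) / (\<zeta> - z)) \<le> 2 / (1 - norm z)"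
    using assms by (auto simp: norm_divide intro!: frac_le)
  show "\<zeta> \<noteq> z" using assms by auto
qed

lemma Re_Herglotz_kernel:
  fixes \<zeta> z :: complex
  assumes "norm \<zeta> = 1"
  shows "Re ((\<zeta> + z) / (\<zeta> - z)) = (1 - (norm z)\<^sup>2) / (norm (\<zeta> - z))\<^sup>2"
proof -
  have "Re ((\<zeta> + z) * cnj (\<zeta> - z)) = (norm \<zeta>)\<^sup>2 - (norm z)\<^sup>2"
    unfolding cmod_power2 by (simp add: power2_eq_square algebra_simps)
  moreover have "(\<zeta> + z) / (\<zeta> - z)
      = ((\<zeta> + z) * cnj (\<zeta> - z)) / complex_of_real ((norm (\<zeta> - z))\<^sup>2)"
    using complex_div_cnj[of "\<zeta> + z" "\<zeta> - z"] by (simp only: of_real_power)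
  ultimately show ?thesis
    using assms by (simp only: Re_divide_of_real power_one)
qed

text \<open>For point masses \<open>c n\<close> at the points \<open>\<zeta> n\<close> of the unit circle the Herglotz integral is a series, and
the associated inner function is its Cayley transform.\<close>

locale atomic_Herglotz =
  fixes c :: "nat \<Rightarrow> real" and \<zeta> :: "nat \<Rightarrow> complex"
  assumes c_nonneg: "\<And>n. 0 \<le> c n" and c_sums: "c sums 1" and norm_\<zeta>: "\<And>n. norm (\<zeta> n) = 1"
begin

definition H :: "complex \<Rightarrow> complex" where
  "H z = (\<Sum>n. c n *\<^sub>R ((\<zeta> n + z) / (\<zeta> n - z)))"

abbreviation \<phi> :: "complex \<Rightarrow> complex" where
  "\<phi> \<equiv> inner_of_measure (atomic_measure c \<zeta>)"

lemma norm_term_le: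
  assumes "norm z < 1"
  shows "norm (c n *\<^sub>R ((\<zeta> n + z) / (\<zeta> n - z))) \<le> c n * (2 / (1 - norm z))"
  by (simp only: norm_scaleR abs_of_nonneg[OF c_nonneg])
    (intro mult_left_mono Herglotz_kernel_bound(1) norm_\<zeta> assms c_nonneg)

lemma summable_norm_terms:
  assumes "norm z < 1"
  shows "summable (\<lambda>n. norm (c n *\<^sub>R ((\<zeta> n + z) / (\<zeta> n - z))))"
  by (rule summable_comparison_test'[OF summable_mult2[OF sums_summable[OF c_sums], of "2 / (1 - norm z)"]])
    (simp only: real_norm_def abs_norm_cancel norm_term_le[OF assms])

lemma terms_sums:
  assumes "norm z < 1"
  shows "(\<lambda>n. c n *\<^sub>R ((\<zeta> n + z) / (\<zeta> n - z))) sums H z"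
  unfolding H_def by (rule summable_sums[OF summable_norm_cancel[OF summable_norm_terms[OF assms]]])

lemma atomic_measure_eq_distr:
  "atomic_measure c \<zeta> = distr (density (count_space UNIV) (\<lambda>n. ennreal (c n))) borel \<zeta>"
proof (rule measure_eqI)
  show "sets (atomic_measure c \<zeta>) =
      sets (distr (density (count_space UNIV) (\<lambda>n. ennreal (c n))) borel \<zeta>)"
    unfolding atomic_measure_def using sets.sigma_sets_eq[of "borel :: complex measure"] by simp
  fix A assume "A \<in> sets (atomic_measure c \<zeta>)"
  then have A: "A \<in> sets borel"
    unfolding atomic_measure_def using sets.sigma_sets_eq[of "borel :: complex measure"] by simp
  have "emeasure (distr (density (count_space UNIV) (\<lambda>n. ennreal (c n))) borel \<zeta>) A
      = (\<integral>\<^sup>+ n. ennreal (c n) * indicator (\<zeta> -` A) n \<partial>count_space UNIV)"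
    using A by (simp add: emeasure_distr emeasure_density)
  also have "\<dots> = (\<Sum>n. ennreal (c n) * emeasure (return borel (\<zeta> n)) A)"
    using A by (simp add: nn_integral_count_space_nat indicator_vimage)
  finally show "emeasure (atomic_measure c \<zeta>) A =
      emeasure (distr (density (count_space UNIV) (\<lambda>n. ennreal (c n))) borel \<zeta>) A"
    using emeasure_atomic_measure[OF A] by simp
qed

lemma herglotz_atomic_measure:
  assumes "norm z < 1"
  shows "herglotz (atomic_measure c \<zeta>) z = H z"
proof -
  let ?f = "\<lambda>x. indicator (sphere 0 1) x *\<^sub>R ((x + z) / (x - z))"
  have [measurable]: "sphere (0::complex) 1 \<in> sets borel"
    by simp
  have [measurable]: "?f \<in> borel_measurable borel"
    by measurable
  have f\<zeta>: "?f (\<zeta> n) = (\<zeta> n + z) / (\<zeta> n - z)" for n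
    using norm_\<zeta> by simp
  have "herglotz (atomic_measure c \<zeta>) z
      = integral\<^sup>L (density (count_space UNIV) (\<lambda>n. ennreal (c n))) (\<lambda>n. ?f (\<zeta> n))"
    unfolding herglotz_def set_lebesgue_integral_def atomic_measure_eq_distr
    by (intro integral_distr) auto
  also have "\<dots> = integral\<^sup>L (count_space UNIV) (\<lambda>n. c n *\<^sub>R ?f (\<zeta> n))"
    using c_nonneg by (intro integral_density) auto
  also have "\<dots> = H z"
    unfolding f\<zeta> H_def
    by (intro integral_count_space_nat) (simp only: integrable_count_space_nat_iff summable_norm_terms[OF assms])
  finally show ?thesis .
qed

lemma \<phi>_eq: "norm z < 1 \<Longrightarrow> \<phi> z = (H z - 1) / (H z + 1)"
  by (simp add: inner_of_measure_def herglotz_atomic_measure)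

lemma Re_H_sums:
  assumes "norm z < 1"
  shows "(\<lambda>n. c n * ((1 - (norm z)\<^sup>2) / (norm (\<zeta> n - z))\<^sup>2)) sums Re (H z)"
  using sums_Re[OF terms_sums[OF assms]]
  by (simp only: scaleR_complex.sel Re_Herglotz_kernel[OF norm_\<zeta>])

text \<open>The zeros of the inner function are the points where \<open>H\<close> takes the value \<open>1\<close>, so its distance from
\<open>1\<close> is the quantity to be bounded below. In this form each \<open>\<zeta> n\<close> enters through a single
Cauchy kernel.\<close>

lemma H_minus_1_sums:
  assumes "norm z < 1"
  shows "(\<lambda>n. 2 * z * (complex_of_real (c n) / (\<zeta> n - z))) sums (H z - 1)"
proof -
  have "(\<lambda>n. c n *\<^sub>R ((\<zeta> n + z) / (\<zeta> n - z)) - complex_of_real (c n)) sums (H z - complex_of_real 1)"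
    by (intro sums_diff terms_sums assms sums_of_real c_sums)
  moreover have "c n *\<^sub>R ((\<zeta> n + z) / (\<zeta> n - z)) - complex_of_real (c n)
      = 2 * z * (complex_of_real (c n) / (\<zeta> n - z))" for n
    using Herglotz_kernel_bound(2)[OF norm_\<zeta> assms, of n]
    by (simp add: scaleR_conv_of_real divide_simps) (simp add: algebra_simps)
  ultimately show ?thesis by (simp only: of_real_1)
qed

lemma c_pos_ex: "\<exists>n. 0 < c n"
proof (rule ccontr)
  assume "\<not> (\<exists>n. 0 < c n)"
  then have "c = (\<lambda>_. 0)"
    using c_nonneg by (metis less_eq_real_def)
  then have "c sums 0" by simp
  then show False using sums_unique2[OF c_sums, of 0] by simp
qed

lemma Re_H_pos:
  assumes "norm z < 1"
  shows "0 < Re (H z)"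
proof -
  have z2: "0 < 1 - (norm z)\<^sup>2"
    using assms by (simp add: abs_square_less_1)
  have P: "0 < (1 - (norm z)\<^sup>2) / (norm (\<zeta> n - z))\<^sup>2" for n
  proof (rule divide_pos_pos[OF z2])
    show "0 < (norm (\<zeta> n - z))\<^sup>2"
      using Herglotz_kernel_bound(2)[OF norm_\<zeta> assms, of n] by simp
  qed
  obtain n where "0 < c n"
    using c_pos_ex ..
  then have "0 < c n * ((1 - (norm z)\<^sup>2) / (norm (\<zeta> n - z))\<^sup>2)"
    using P[of n] by (intro mult_pos_pos)
  also have "\<dots> = (\<Sum>n\<in>{n}. c n * ((1 - (norm z)\<^sup>2) / (norm (\<zeta> n - z))\<^sup>2))"
    by simp
  also have "\<dots> \<le> (\<Sum>n. c n * ((1 - (norm z)\<^sup>2) / (norm (\<zeta> n - z))\<^sup>2))"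
    by (rule sum_le_suminf[OF sums_summable[OF Re_H_sums[OF assms]] finite.intros(2)[OF finite.intros(1)]])
      (intro mult_nonneg_nonneg c_nonneg less_imp_le[OF P])
  also have "\<dots> = Re (H z)"
    by (rule sums_unique[OF Re_H_sums[OF assms], symmetric])
  finally show ?thesis .
qed

lemma H_holomorphic: "H holomorphic_on ball 0 1"
proof (rule holomorphic_uniform_sequence[OF open_ball])
  fix n
  show "(\<lambda>z. \<Sum>k<n. c k *\<^sub>R ((\<zeta> k + z) / (\<zeta> k - z))) holomorphic_on ball 0 1"
    unfolding scaleR_conv_of_real using Herglotz_kernel_bound(2)[OF norm_\<zeta>]
    by (intro holomorphic_intros) auto
next
  fix x :: complex assume "x \<in> ball 0 1"
  then have x: "norm x < 1" by simp
  define d where "d = (1 - norm x) / 2"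
  have d: "d > 0" using x by (simp add: d_def)
  have near: "norm z \<le> 1 - d" if "z \<in> cball x d" for z
    using that norm_triangle_ineq2[of z x] by (simp add: d_def dist_norm norm_minus_commute field_simps)
  have "uniform_limit (cball x d) (\<lambda>n z. \<Sum>k<n. c k *\<^sub>R ((\<zeta> k + z) / (\<zeta> k - z))) H sequentially"
    unfolding H_def
  proof (rule Weierstrass_m_test)
    fix n z assume "z \<in> cball x d"
    note near[OF this]
    then have "norm (c n *\<^sub>R ((\<zeta> n + z) / (\<zeta> n - z))) \<le> c n * (2 / (1 - norm z))"
      using d by (intro norm_term_le) auto
    also have "\<dots> \<le> c n * (2 / d)"
      using \<open>norm z \<le> 1 - d\<close> d c_nonneg by (intro mult_left_mono divide_left_mono) auto
    finally show "norm (c n *\<^sub>R ((\<zeta> n + z) / (\<zeta> n - z))) \<le> c n * (2 / d)" .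
  qed (intro summable_mult2 sums_summable[OF c_sums])
  moreover have "cball x d \<subseteq> ball 0 1"
    using near d by force
  ultimately show "\<exists>d>0. cball x d \<subseteq> ball 0 1 \<and>
      uniform_limit (cball x d) (\<lambda>n z. \<Sum>k<n. c k *\<^sub>R ((\<zeta> k + z) / (\<zeta> k - z))) H sequentially"
    using d by blast
qed

lemma \<phi>_holomorphic: "\<phi> holomorphic_on ball 0 1"
proof -
  have "(\<lambda>z. (H z - 1) / (H z + 1)) holomorphic_on ball 0 1"
    using Re_H_pos by (intro holomorphic_intros H_holomorphic) (force simp: complex_eq_iff)
  then show ?thesis
    by (rule holomorphic_transform) (simp only: \<phi>_eq mem_ball_0)
qed

lemma norm_\<phi>_le_1: "norm z < 1 \<Longrightarrow> norm (\<phi> z) \<le> 1"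
  by (simp only: \<phi>_eq norm_Cayley(1)[OF Re_H_pos])

end

section \<open>Chords and arcs of the unit circle\<close>

lemma third_le_sin:
  fixes x :: real
  assumes "0 \<le> x" "x \<le> 2"
  shows "x / 3 \<le> sin x"
proof -
  define f where "f = (\<lambda>x::real. sin x - x + x ^ 3 / 6)"
  have "f 0 \<le> f x"
  proof (rule DERIV_nonneg_imp_nondecreasing[OF assms(1)])
    fix y :: real
    have "(f has_real_derivative cos y - 1 + y\<^sup>2 / 2) (at y)"
      unfolding f_def by (auto intro!: derivative_eq_intros simp: power2_eq_square)
    moreover have "cos y = 1 - 2 * (sin (y / 2))\<^sup>2"
      using cos_double_sin[of "y / 2"] by simp
    moreover have "(sin (y / 2))\<^sup>2 \<le> (y / 2)\<^sup>2"
      using abs_sin_x_le_abs_x[of "y / 2"] by (rule abs_le_square_iff[THEN iffD1])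
    ultimately show "\<exists>D. (f has_real_derivative D) (at y) \<and> 0 \<le> D"
      by (intro exI[of _ "cos y - 1 + y\<^sup>2 / 2"]) (auto simp: power2_eq_square)
  qed
  moreover have "x ^ 3 \<le> 4 * x"
  proof -
    have "x * x \<le> 2 * 2" using assms by (intro mult_mono) auto
    from mult_left_mono[OF this assms(1)] show ?thesis by (simp add: power3_eq_cube)
  qed
  ultimately show ?thesis
    by (simp add: f_def)
qed

lemma norm_cis_diff: "norm (cis s - cis t) = 2 * \<bar>sin ((s - t) / 2)\<bar>"
proof -
  have "(norm (cis s - cis t))\<^sup>2 = (cos s - cos t)\<^sup>2 + (sin s - sin t)\<^sup>2"
    by (simp add: cmod_power2)
  also have "\<dots> = 2 - 2 * cos (s - t)"
    using sin_cos_squared_add[of s] sin_cos_squared_add[of t]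
    by (simp add: cos_diff power2_diff algebra_simps)
  also have "cos (s - t) = 1 - 2 * (sin ((s - t) / 2))\<^sup>2"
    by (metis cos_double_sin nonzero_mult_div_cancel_left times_divide_eq_right zero_neq_numeral)
  also have "2 - 2 * (1 - 2 * (sin ((s - t) / 2))\<^sup>2) = (2 * \<bar>sin ((s - t) / 2)\<bar>)\<^sup>2"
    by (simp add: power_mult_distrib)
  finally show ?thesis
    by (rule power2_eq_imp_eq) auto
qed

lemma norm_cis_diff_le: "norm (cis s - cis t) \<le> \<bar>s - t\<bar>"
  using abs_sin_x_le_abs_x[of "(s - t) / 2"] by (simp add: norm_cis_diff)

text \<open>If two points of the circle lie within \<open>r\<close> of \<open>v\<close>, they are within \<open>2 * r\<close> of each other. So it is
enough to bound the arc around one such point \<open>cis s\<close>, which in \<open>[0, 2 * pi)\<close> is an interval around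
\<open>s\<close> together with possible wrapped pieces at both ends.\<close>

lemma emeasure_uniform_cis_near:
  assumes r: "0 \<le> r"
  shows "emeasure (uniform_measure lborel {0..<2 * pi}) {t. norm (cis t - v) \<le> r} \<le> ennreal (4 * r)"
proof -
  have cl: "{t. norm (cis t - v) \<le> r} \<in> sets borel"
    by (intro borel_closed closed_Collect_le continuous_intros)
  let ?I = "{0..<2 * pi} \<inter> {t. norm (cis t - v) \<le> r}"
  have "emeasure lborel ?I \<le> ennreal (24 * r)"
  proof (cases "?I = {}")
    case True
    then show ?thesis by simp
  next
    case False
    then obtain s where s: "s \<in> ?I" by blast
    have "?I \<subseteq> {s - 6 * r..s + 6 * r} \<union> ({0..6 * r} \<union> {2 * pi - 6 * r..2 * pi})"
    proof
      fix t assume t: "t \<in> ?I"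
      \<comment> \<open>Half the angle between the points; the chord between them has length \<open>2 * sin u\<close>.\<close>
      define u where "u = \<bar>t - s\<bar> / 2"
      have u: "0 \<le> u" "u < pi"
        using s t by (auto simp: u_def abs_if)
      have "norm (cis t - cis s) \<le> norm (cis t - v) + norm (cis s - v)"
        using norm_triangle_ineq4[of "cis t - v" "cis s - v"] by simp
      also have "\<dots> \<le> 2 * r"
        using s t by auto
      finally have "\<bar>sin ((t - s) / 2)\<bar> \<le> r"
        by (simp add: norm_cis_diff)
      moreover have "\<bar>sin ((t - s) / 2)\<bar> = sin u"
      proof -
        have "\<bar>sin ((t - s) / 2)\<bar> = \<bar>sin u\<bar>"
          using sin_minus[of "(t - s) / 2"] by (auto simp: u_def abs_if minus_divide_left)
        then show ?thesis using sin_ge_zero[of u] u by simp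
      qed
      ultimately have su: "sin u \<le> r" by simp
      have "u \<le> 3 * r \<or> pi - u \<le> 3 * r"
      proof (cases "u \<le> 2")
        case True
        then show ?thesis using third_le_sin[of u] u su by simp
      next
        case False
        then have "pi - u \<le> 2" using pi_less_4 by simp
        then show ?thesis using third_le_sin[of "pi - u"] u su by simp
      qed
      then have "\<bar>t - s\<bar> \<le> 6 * r \<or> 2 * pi - 6 * r \<le> \<bar>t - s\<bar>"
        by (auto simp: u_def)
      then show "t \<in> {s - 6 * r..s + 6 * r} \<union> ({0..6 * r} \<union> {2 * pi - 6 * r..2 * pi})"
        using s t by (cases "t \<le> s") auto
    qed
    then have "emeasure lborel ?I
        \<le> emeasure lborel ({s - 6 * r..s + 6 * r} \<union> ({0..6 * r} \<union> {2 * pi - 6 * r..2 * pi}))"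
      by (intro emeasure_mono) auto
    also have "\<dots> \<le> emeasure lborel {s - 6 * r..s + 6 * r} +
        (emeasure lborel {0..6 * r} + emeasure lborel {2 * pi - 6 * r..2 * pi})"
      by (intro order_trans[OF emeasure_subadditive] add_left_mono) auto
    also have "\<dots> = ennreal (24 * r)"
      using r by (simp flip: ennreal_plus)
    finally show ?thesis .
  qed
  moreover have "emeasure (uniform_measure lborel {0..<2 * pi}) {t. norm (cis t - v) \<le> r}
      = emeasure lborel ?I / emeasure lborel {0..<2 * pi}"
    using cl by (intro emeasure_uniform_measure) auto
  ultimately have "emeasure (uniform_measure lborel {0..<2 * pi}) {t. norm (cis t - v) \<le> r}
      \<le> ennreal (24 * r) / ennreal (2 * pi)"
    by (simp add: divide_right_mono_ennreal)
  also have "\<dots> = ennreal (24 * r / (2 * pi))"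
    using r by (intro divide_ennreal) auto
  also have "\<dots> \<le> ennreal (4 * r)"
    using mult_right_mono[of 3 pi r] pi_gt3 r by (intro ennreal_leI) (simp add: field_simps)
  finally show ?thesis .
qed

text \<open>The map from \<open>\<zeta>\<close> to \<open>1 / (\<zeta> - z)\<close> expands distances on the unit circle by at least \<open>1 / 4\<close>,
because \<open>\<zeta> - z\<close> has modulus at most \<open>2\<close>. So the points whose images fall into a small disc lie in
a short arc, with a bound that does not deteriorate as \<open>z\<close> approaches the circle. The bound is
uniform in \<open>w\<close>, which will be the contribution of all other point masses.\<close>

lemma emeasure_uniform_Cauchy_near:
  fixes z w :: complex
  assumes z: "1 / 2 \<le> norm z" "norm z < 1" and "0 < a" "0 \<le> t"
  shows "emeasure (uniform_measure lborel {0..<2 * pi})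
    {x. norm (2 * z * (complex_of_real a / (cis x - z)) + w) \<le> t} \<le> ennreal (32 * t / a)"
    (is "emeasure ?U ?S \<le> _")
proof (cases "?S = {}")
  case False
  then obtain x0 where x0: "x0 \<in> ?S" by blast
  have nz: "cis x \<noteq> z" for x using z by auto
  have "?S \<subseteq> {x. norm (cis x - cis x0) \<le> 8 * t / a}"
  proof
    fix x assume x: "x \<in> ?S"
    define C where "C = (\<lambda>x. 2 * z * (complex_of_real a / (cis x - z)))"
    have "norm (C x - C x0) \<le> norm (C x + w) + norm (C x0 + w)"
      using norm_triangle_ineq4[of "C x + w" "C x0 + w"] by simp
    also have "\<dots> \<le> 2 * t" using x x0 by (simp add: C_def)
    finally have C: "norm (C x - C x0) \<le> 2 * t" .
    have two: "norm (cis y - z) \<le> 2" for y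
      using norm_triangle_ineq4[of "cis y" z] z by simp
    have "a * norm (cis x - cis x0) \<le> 2 * norm z * (a * norm (cis x - cis x0))"
      using mult_right_mono[of 1 "2 * norm z" "a * norm (cis x - cis x0)"] z assms by simp
    also have "C x - C x0 = 2 * z * complex_of_real a * (cis x0 - cis x) / ((cis x - z) * (cis x0 - z))"
      using nz by (simp add: C_def divide_simps) (simp add: algebra_simps)
    then have "2 * norm z * (a * norm (cis x - cis x0))
        = norm (C x - C x0) * (norm (cis x - z) * norm (cis x0 - z))"
      using nz nz[THEN not_sym] assms by (simp add: norm_mult norm_divide norm_minus_commute)
    also have "\<dots> \<le> (2 * t) * (2 * 2)"
      using C two assms by (intro mult_mono) auto
    finally show "x \<in> {x. norm (cis x - cis x0) \<le> 8 * t / a}"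
      using assms by (simp add: field_simps)
  qed
  moreover have "{x. norm (cis x - cis x0) \<le> 8 * t / a} \<in> sets ?U"
    by (simp add: borel_closed closed_Collect_le continuous_intros)
  ultimately have "emeasure ?U ?S \<le> emeasure ?U {x. norm (cis x - cis x0) \<le> 8 * t / a}"
    by (rule emeasure_mono)
  also have "\<dots> \<le> ennreal (4 * (8 * t / a))"
    using assms by (intro emeasure_uniform_cis_near) auto
  finally show ?thesis by simp
next
  case True
  then show ?thesis by (simp only: emeasure_empty) simp
qed

section \<open>A grid in the unit disc\<close>

text \<open>Level \<open>j\<close> of the grid consists of equally spaced points on the circle of radius \<open>1 - grid_gap j\<close>.
The ratio \<open>7 / 8\<close> of consecutive gaps and the number of points are chosen so that the discs of
radius \<open>grid_gap j / 4\<close> around them cover the annulus up to the next level, while the discs with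
three times that radius still lie in the unit disc. The factor \<open>1 / 2\<close> keeps all grid points away
from \<open>0\<close>, which is always a zero of the inner function.\<close>

definition grid_gap :: "nat \<Rightarrow> real" where
  "grid_gap j = (7 / 8) ^ j / 2"

definition grid_size :: "nat \<Rightarrow> nat" where
  "grid_size j = nat \<lceil>64 / grid_gap j\<rceil>"

definition grid_point :: "nat \<Rightarrow> nat \<Rightarrow> complex" where
  "grid_point j k = complex_of_real (1 - grid_gap j) * cis (2 * pi * k / grid_size j)"

lemma grid_gap_pos: "0 < grid_gap j" and grid_gap_le: "grid_gap j \<le> 1 / 2"
  by (auto simp: grid_gap_def power_le_one)

lemma grid_gap_Suc: "grid_gap (Suc j) = 7 / 8 * grid_gap j"
  by (simp add: grid_gap_def)

lemma grid_gap_antimono: "i \<le> j \<Longrightarrow> grid_gap j \<le> grid_gap i"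
  by (auto simp: grid_gap_def power_decreasing)

lemma grid_size_bounds:
  shows "64 \<le> grid_size j * grid_gap j" and "grid_size j * grid_gap j \<le> 65"
proof -
  have pos: "0 < 64 / grid_gap j" using grid_gap_pos[of j] by simp
  have size: "real (grid_size j) = of_int \<lceil>64 / grid_gap j\<rceil>"
    unfolding grid_size_def using pos by (intro of_nat_nat) linarith
  have "64 / grid_gap j \<le> grid_size j" "grid_size j \<le> 64 / grid_gap j + 1"
    unfolding size by linarith+
  then have "64 \<le> grid_size j * grid_gap j" "grid_size j * grid_gap j \<le> 64 + grid_gap j"
    using grid_gap_pos[of j] by (simp_all add: field_simps)
  then show "64 \<le> grid_size j * grid_gap j" "grid_size j * grid_gap j \<le> 65"
    using grid_gap_le[of j] by linarith+
qed

lemma norm_grid_point: "norm (grid_point j k) = 1 - grid_gap j"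
  using grid_gap_le[of j] by (simp add: grid_point_def norm_mult del: of_real_diff)

lemma norm_grid_point_ge: "1 / 2 \<le> norm (grid_point j k)"
  and norm_grid_point_less: "norm (grid_point j k) < 1"
  using grid_gap_le[of j] grid_gap_pos[of j] by (simp_all add: norm_grid_point)

lemma grid_level_ex:
  assumes "0 < x" "x \<le> grid_gap J"
  obtains j where "J \<le> j" "7 / 8 * grid_gap j \<le> x" "x \<le> grid_gap j"
proof -
  obtain n where "(7 / 8 :: real) ^ n < x"
    using real_arch_pow_inv[of x "7 / 8"] assms by auto
  then have ex: "\<exists>n. grid_gap n < x"
    using assms by (intro exI[of _ n]) (simp add: grid_gap_def)
  define n where "n = (LEAST n. grid_gap n < x)"
  have n: "grid_gap n < x"
    unfolding n_def using ex by (rule LeastI_ex)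
  have "J < n"
    using n assms grid_gap_antimono[of n J] by (cases "n \<le> J") auto
  then obtain j where j: "n = Suc j" by (cases n) auto
  have "\<not> grid_gap j < x"
    using not_less_Least[of j "\<lambda>n. grid_gap n < x"] j by (simp add: n_def)
  then show ?thesis
    using that[of j] n j \<open>J < n\<close> by (simp add: grid_gap_Suc)
qed

lemma grid_cover:
  assumes "7 / 8 * grid_gap j \<le> 1 - norm w" "1 - norm w \<le> grid_gap j"
  obtains k where "k < grid_size j" "w \<in> cball (grid_point j k) (grid_gap j / 4)"
proof -
  define m \<delta> \<tau> where "m = grid_size j" and "\<delta> = grid_gap j" and "\<tau> = Arg2pi w"
  have \<delta>: "0 < \<delta>" "\<delta> \<le> 1 / 2" using grid_gap_pos grid_gap_le by (auto simp: \<delta>_def)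
  have m\<delta>: "64 \<le> m * \<delta>" using grid_size_bounds(1) by (simp add: m_def \<delta>_def)
  then have m: "0 < real m" using \<delta> by (cases "m = 0") auto
  have \<tau>: "0 \<le> \<tau>" "\<tau> < 2 * pi" and w: "w = complex_of_real (norm w) * cis \<tau>"
    using Arg2pi[of w] by (auto simp: \<tau>_def cis_conv_exp is_Arg_def)
  \<comment> \<open>The index of the grid point next to \<open>w\<close> in the clockwise direction.\<close>
  define x where "x = \<tau> * m / (2 * pi)"
  have x: "0 \<le> x" "x < m" using \<tau> m by (auto simp: x_def field_simps)
  define k where "k = nat \<lfloor>x\<rfloor>"
  have k: "real k \<le> x" "x < real k + 1" using x by (auto simp: k_def of_nat_nat)
  have km: "k < m" using k x by linarith
  define \<sigma> where "\<sigma> = 2 * pi * k / m"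
  have "\<tau> - \<sigma> = 2 * pi / m * (x - k)" using m by (simp add: x_def \<sigma>_def field_simps)
  then have "\<bar>\<tau> - \<sigma>\<bar> = 2 * pi / m * \<bar>x - k\<bar>" using m by (simp add: abs_mult)
  also have "\<dots> \<le> 2 * pi / m * 1" using k m by (intro mult_left_mono) auto
  also have "\<dots> \<le> 8 / m" using m pi_less_4 by (intro order_trans[OF _ divide_right_mono[of "2 * pi" 8]]) auto
  also have "\<dots> \<le> \<delta> / 8" using m m\<delta> by (simp add: field_simps)
  finally have "norm (cis \<tau> - cis \<sigma>) \<le> \<delta> / 8"
    using norm_cis_diff_le order_trans by blast
  then have "(1 - \<delta>) * norm (cis \<tau> - cis \<sigma>) \<le> 1 * (\<delta> / 8)"
    using \<delta> by (intro mult_mono) auto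
  moreover have "\<bar>norm w - (1 - \<delta>)\<bar> \<le> \<delta> / 8"
    using assms by (auto simp: \<delta>_def)
  \<comment> \<open>The radial and the angular deviation each take up half of the radius \<open>\<delta> / 4\<close>.\<close>
  moreover have "w - grid_point j k = complex_of_real (norm w - (1 - \<delta>)) * cis \<tau>
      + complex_of_real (1 - \<delta>) * (cis \<tau> - cis \<sigma>)"
    by (subst w) (simp add: grid_point_def \<delta>_def \<sigma>_def m_def algebra_simps)
  then have "norm (w - grid_point j k) \<le> norm (complex_of_real (norm w - (1 - \<delta>)) * cis \<tau>)
      + norm (complex_of_real (1 - \<delta>) * (cis \<tau> - cis \<sigma>))"
    by (metis norm_triangle_ineq)
  then have "norm (w - grid_point j k) \<le> \<bar>norm w - (1 - \<delta>)\<bar> + (1 - \<delta>) * norm (cis \<tau> - cis \<sigma>)"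
    using \<delta> by (simp add: norm_mult del: of_real_diff)
  ultimately have "norm (w - grid_point j k) \<le> \<delta> / 4" by linarith
  then show ?thesis
    using that[of k] km by (simp add: m_def \<delta>_def dist_norm norm_minus_commute)
qed

lemma summable_grid_gap_powr:
  assumes "0 < e"
  shows "summable (\<lambda>j. grid_gap j powr e)"
proof -
  have "(7 / 8 :: real) powr e < 1"
    using powr_less_mono2[of e "7 / 8" 1] assms by simp
  then have "summable (\<lambda>j. ((7 / 8 :: real) powr e) ^ j * (1 / 2) powr e)"
    by (intro summable_mult2 summable_geometric) auto
  then show ?thesis
    by (simp add: grid_gap_def powr_mult powr_divide power_powr)
qed

lemma ln_grid_gap_nonneg: "0 \<le> ln (1 / grid_gap j)"
  using grid_gap_pos[of j] grid_gap_le[of j] by (intro ln_ge_zero) auto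

lemma summable_ln_grid_gap_powr:
  assumes e: "0 < e"
  shows "summable (\<lambda>j. (1 + ln (1 / grid_gap j)) * grid_gap j powr e)"
proof (rule summable_comparison_test')
  show "summable (\<lambda>j. (1 + 2 / e) * grid_gap j powr (e / 2))"
    using e by (intro summable_mult summable_grid_gap_powr) auto
  fix j
  define \<delta> where "\<delta> = grid_gap j"
  have \<delta>: "0 < \<delta>" "\<delta> \<le> 1" using grid_gap_pos[of j] grid_gap_le[of j] by (auto simp: \<delta>_def)
  have inv: "(1 / \<delta>) powr (e / 2) = \<delta> powr (- (e / 2))"
    using \<delta> by (simp add: powr_divide powr_minus_divide)
  have "ln (1 / \<delta>) \<le> (1 / \<delta>) powr (e / 2) / (e / 2)"
    using \<delta> e by (intro ln_powr_bound) auto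
  then have "(1 + ln (1 / \<delta>)) * \<delta> powr e \<le> (1 + \<delta> powr (- (e / 2)) / (e / 2)) * \<delta> powr e"
    unfolding inv by (intro mult_right_mono) auto
  also have "\<dots> = \<delta> powr e + 2 / e * (\<delta> powr (- (e / 2)) * \<delta> powr e)"
    using e by (simp add: algebra_simps)
  also have "\<delta> powr (- (e / 2)) * \<delta> powr e = \<delta> powr (e / 2)"
    by (simp flip: powr_add)
  also have "\<delta> powr e + 2 / e * \<delta> powr (e / 2) \<le> (1 + 2 / e) * \<delta> powr (e / 2)"
    using \<delta> e powr_mono'[of "e / 2" e \<delta>] by (simp add: distrib_right)
  finally show "norm ((1 + ln (1 / grid_gap j)) * grid_gap j powr e)
      \<le> (1 + 2 / e) * grid_gap j powr (e / 2)"
    using ln_grid_gap_nonneg[of j] by (simp add: \<delta>_def)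
qed

section \<open>Zeros controlled by values on the grid\<close>

lemma disk_zeros_eq: "disk_zeros f = zeros_in (ball 0 1) f"
  by (simp add: disk_zeros_def zeros_in_def)

lemma mem_zeros_in_iff: "(w, i) \<in> zeros_in K f \<longleftrightarrow> w \<in> K \<and> f w = 0 \<and> i < nat (zorder f w)"
  by (auto simp: zeros_in_def)

context atomic_Herglotz
begin

lemma \<phi>_nonzero:
  assumes "norm z < 1" "H z \<noteq> 1"
  shows "\<phi> z \<noteq> 0"
proof -
  have "H z + 1 \<noteq> 0"
    using Re_H_pos[OF assms(1)] by (auto simp: complex_eq_iff)
  then show ?thesis
    using assms by (simp add: \<phi>_eq)
qed

text \<open>Jensen's inequality in the disc around \<open>a\<close>, combined with the bound for
\<open>ln (1 / \<bar>\<phi> a\<bar>)\<close>.\<close>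

lemma card_zeros_near_le:
  fixes a :: complex
  assumes \<delta>: "0 < \<delta>" "\<delta> < 1" and a: "norm a = 1 - \<delta>" and p: "0 < p" "p \<le> 1"
    and far: "\<delta> ^ 4 \<le> norm (H a - 1)"
  shows "finite (zeros_in (cball a (\<delta> / 4)) \<phi>)"
    and "card (zeros_in (cball a (\<delta> / 4)) \<phi>) \<le> 16 * (1 + ln (1 / \<delta>)) * Re (H a) powr p"
proof -
  have a1: "norm a < 1" using a \<delta> by simp
  have sub: "ball a (7 / 8 * \<delta>) \<subseteq> ball 0 1"
  proof
    fix z assume "z \<in> ball a (7 / 8 * \<delta>)"
    then show "z \<in> ball 0 1"
      using norm_triangle_ineq[of a "z - a"] a \<delta> by (simp add: dist_norm norm_minus_commute)
  qed
  have hol: "\<phi> holomorphic_on ball a (7 / 8 * \<delta>)"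
    using \<phi>_holomorphic sub by (rule holomorphic_on_subset)
  have H1: "H a \<noteq> 1" using far \<delta> by auto
  have nz: "\<phi> a \<noteq> 0"
    by (rule \<phi>_nonzero[OF a1 H1])
  have bd: "norm (\<phi> z) \<le> 1" if "z \<in> ball a (7 / 8 * \<delta>)" for z
    using that sub by (intro norm_\<phi>_le_1) auto
  define N where "N = card (zeros_in (cball a (\<delta> / 4)) \<phi>)"
  show "finite (zeros_in (cball a (\<delta> / 4)) \<phi>)"
    by (rule zero_count_le(1)[OF hol _ _ bd nz]) (use \<delta> in auto)
  have "2 ^ N * norm (\<phi> a) \<le> 1"
    unfolding N_def by (rule zero_count_le(2)[OF hol _ _ bd nz]) (use \<delta> in auto)
  then have "(2 ^ N * norm (\<phi> a))\<^sup>2 \<le> 1"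
    by (simp add: power_le_one)
  then have "(2 ^ N)\<^sup>2 \<le> 1 / (norm (\<phi> a))\<^sup>2"
    using nz by (simp add: power_mult_distrib field_simps)
  also have "\<dots> = 1 + 4 * Re (H a) / (norm (H a - 1))\<^sup>2"
    unfolding \<phi>_eq[OF a1] by (rule norm_Cayley(2)[OF Re_H_pos[OF a1] H1])
  finally have "(2 ^ N)\<^sup>2 \<le> 1 + 4 * Re (H a) / (norm (H a - 1))\<^sup>2" .
  moreover have "(2 ^ N)\<^sup>2 = (4 :: real) ^ N"
    by (simp add: power2_eq_square flip: power_mult_distrib)
  ultimately have "ln (4 ^ N) \<le> ln (1 + 4 * Re (H a) / (norm (H a - 1))\<^sup>2)"
    by (intro ln_mono) auto
  moreover have "1 \<le> ln (4 :: real)"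
    using exp_le by (subst ln_ge_iff) auto
  then have "real N * 1 \<le> real N * ln 4"
    by (intro mult_left_mono) auto
  ultimately have "real N \<le> ln (1 + 4 * Re (H a) / (norm (H a - 1))\<^sup>2)"
    by (simp add: ln_realpow)
  also have "\<dots> \<le> 16 * (1 + ln (1 / \<delta>)) * Re (H a) powr p"
    using \<delta> by (intro ln_deficit_le Re_H_pos a1 p far) auto
  finally show "card (zeros_in (cball a (\<delta> / 4)) \<phi>) \<le> 16 * (1 + ln (1 / \<delta>)) * Re (H a) powr p"
    by (simp add: N_def)
qed

text \<open>The deterministic half of the theorem. Up to finitely many, the zeros lie in the grid discs of the
levels from \<open>J\<close> on, and the level \<open>j\<close> of the disc can be chosen such that the zero contributes at
most \<open>grid_gap j powr s\<close>. The number of zeros in each disc is bounded by \<open>card_zeros_near_le\<close>.\<close>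

lemma zeros_summable_if_grid_summable:
  fixes p s :: real
  assumes p: "0 < p" "p \<le> 1" and s: "0 < s"
    and far: "\<And>j k. J \<le> j \<Longrightarrow> k < grid_size j \<Longrightarrow> grid_gap j ^ 4 \<le> norm (H (grid_point j k) - 1)"
    and sm: "summable (\<lambda>j. \<Sum>k<grid_size j.
      grid_gap j powr s * (1 + ln (1 / grid_gap j)) * Re (H (grid_point j k)) powr p)"
  shows "(\<lambda>(w, i). (1 - norm w) powr s) summable_on disk_zeros \<phi>"
proof -
  define u where "u = (\<lambda>j k. grid_gap j powr s * (1 + ln (1 / grid_gap j)) * Re (H (grid_point j k)) powr p)"
  define B where "B = (\<lambda>(j, k). zeros_in (cball (grid_point j k) (grid_gap j / 4)) \<phi>)"
  define g where "g = (\<lambda>(w :: complex, i :: nat). (1 - norm w) powr s)"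
  define core where "core = zeros_in (cball 0 (1 - grid_gap J)) \<phi>"
  define shell where "shell = disk_zeros \<phi> - core"
  have sm': "summable (\<lambda>j. \<Sum>k<grid_size j. u j k)"
    unfolding u_def by (rule sm)
  have u0: "0 \<le> u j k" for j k
  proof -
    have "0 \<le> ln (1 / grid_gap j)"
      using grid_gap_pos[of j] grid_gap_le[of j] by (intro ln_ge_zero) auto
    then show ?thesis by (simp add: u_def)
  qed
  have B: "finite (B (j, k))" "grid_gap j powr s * card (B (j, k)) \<le> 16 * u j k"
    if "J \<le> j" "k < grid_size j" for j k
  proof -
    note * = card_zeros_near_le[OF grid_gap_pos _ norm_grid_point p far[OF that]]
    have g1: "grid_gap j < 1" using grid_gap_le[of j] by simp
    show "finite (B (j, k))" unfolding B_def using *(1)[OF g1] by simp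
    have "grid_gap j powr s * card (B (j, k))
        \<le> grid_gap j powr s * (16 * (1 + ln (1 / grid_gap j)) * Re (H (grid_point j k)) powr p)"
      unfolding B_def using *(2)[OF g1] by (intro mult_left_mono) auto
    then show "grid_gap j powr s * card (B (j, k)) \<le> 16 * u j k"
      by (simp add: u_def algebra_simps)
  qed
  have core: "finite core"
  proof -
    have "0 < grid_size J"
      using grid_size_bounds(1)[of J] grid_gap_pos[of J] by (cases "grid_size J = 0") auto
    \<comment> \<open>A single grid point shows that \<open>\<phi>\<close> does not vanish identically.\<close>
    from far[OF order_refl this] have H1: "H (grid_point J 0) \<noteq> 1"
      using grid_gap_pos[of J] by auto
    note a1 = norm_grid_point_less[of J 0]
    have nz: "\<phi> (grid_point J 0) \<noteq> 0"
      by (rule \<phi>_nonzero[OF a1 H1])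
    have "finite {w \<in> cball 0 (1 - grid_gap J). \<phi> w = 0}"
      by (rule finite_zero_set[OF \<phi>_holomorphic open_ball connected_ball _ nz])
        (use a1 grid_gap_pos[of J] in auto)
    then show ?thesis unfolding core_def by (rule finite_zeros_in)
  qed
  have "\<exists>y. J \<le> fst y \<and> snd y < grid_size (fst y) \<and> x \<in> B y \<and> g x \<le> grid_gap (fst y) powr s"
    if "x \<in> shell" for x
  proof -
    obtain w i where x: "x = (w, i)" by (cases x)
    from that have w: "norm w < 1" "1 - norm w \<le> grid_gap J" "\<phi> w = 0" "i < nat (zorder \<phi> w)"
      by (auto simp: x shell_def core_def disk_zeros_eq mem_zeros_in_iff)
    obtain j where j: "J \<le> j" "7 / 8 * grid_gap j \<le> 1 - norm w" "1 - norm w \<le> grid_gap j"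
      using grid_level_ex[of "1 - norm w" J] w by auto
    obtain k where k: "k < grid_size j" "w \<in> cball (grid_point j k) (grid_gap j / 4)"
      using grid_cover[OF j(2,3)] by blast
    have "g x \<le> grid_gap j powr s"
      using w j s by (auto simp: g_def x intro!: powr_mono2)
    then show ?thesis
      using j k w by (intro exI[of _ "(j, k)"]) (auto simp: B_def x mem_zeros_in_iff)
  qed
  \<comment> \<open>The discs overlap, so each zero is assigned to one of them.\<close>
  then obtain idx where idx: "\<And>x. x \<in> shell \<Longrightarrow> J \<le> fst (idx x) \<and> snd (idx x) < grid_size (fst (idx x)) \<and>
      x \<in> B (idx x) \<and> g x \<le> grid_gap (fst (idx x)) powr s"
    by metis
  have "g summable_on shell"
  proof (rule nonneg_bdd_above_summable_on)
    show "bdd_above (sum g ` {F. F \<subseteq> shell \<and> finite F})"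
    proof (rule bdd_aboveI2)
      fix F assume "F \<in> {F. F \<subseteq> shell \<and> finite F}"
      then have F: "F \<subseteq> shell" "finite F" by auto
      have "sum g F = (\<Sum>y\<in>idx ` F. \<Sum>x\<in>{x \<in> F. idx x = y}. g x)"
        by (rule sum.image_gen) fact
      also have "\<dots> \<le> (\<Sum>y\<in>idx ` F. 16 * u (fst y) (snd y))"
      proof (rule sum_mono)
        fix y assume "y \<in> idx ` F"
        then have y: "J \<le> fst y" "snd y < grid_size (fst y)" using idx F by auto
        note By = B[OF y, simplified prod.collapse]
        have "(\<Sum>x\<in>{x \<in> F. idx x = y}. g x) \<le> (\<Sum>x\<in>{x \<in> F. idx x = y}. grid_gap (fst y) powr s)"
          using idx F by (intro sum_mono) blast
        also have "\<dots> = grid_gap (fst y) powr s * card {x \<in> F. idx x = y}"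
          by simp
        also have "\<dots> \<le> grid_gap (fst y) powr s * card (B y)"
          using By(1) idx F by (intro mult_left_mono of_nat_mono card_mono) auto
        also have "\<dots> \<le> 16 * u (fst y) (snd y)" by (rule By(2))
        finally show "(\<Sum>x\<in>{x \<in> F. idx x = y}. g x) \<le> 16 * u (fst y) (snd y)" .
      qed
      also have "\<dots> \<le> (\<Sum>y\<in>(SIGMA j:{..Max (fst ` idx ` F)}. {..<grid_size j}). 16 * u (fst y) (snd y))"
      proof (rule sum_mono2)
        show "idx ` F \<subseteq> (SIGMA j:{..Max (fst ` idx ` F)}. {..<grid_size j})"
        proof
          fix y assume y: "y \<in> idx ` F"
          then have "fst y \<le> Max (fst ` idx ` F)" using F by (intro Max_ge) auto
          moreover have "snd y < grid_size (fst y)" using y idx F by auto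
          ultimately show "y \<in> (SIGMA j:{..Max (fst ` idx ` F)}. {..<grid_size j})"
            by (cases y) auto
        qed
      qed (use u0 in auto)
      also have "\<dots> = 16 * (\<Sum>j\<le>Max (fst ` idx ` F). \<Sum>k<grid_size j. u j k)"
        by (simp add: sum.Sigma sum_distrib_left split_beta)
      also have "\<dots> \<le> 16 * (\<Sum>j. \<Sum>k<grid_size j. u j k)"
        using u0 by (intro mult_left_mono sum_le_suminf sm') (auto intro!: sum_nonneg)
      finally show "sum g F \<le> 16 * (\<Sum>j. \<Sum>k<grid_size j. u j k)" .
    qed
  qed (auto simp: g_def)
  moreover have "g summable_on (core \<inter> disk_zeros \<phi>)"
    using core by (intro summable_on_finite) auto
  ultimately have "g summable_on ((core \<inter> disk_zeros \<phi>) \<union> shell)"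
    by (intro summable_on_Un_disjoint) (auto simp: shell_def)
  also have "(core \<inter> disk_zeros \<phi>) \<union> shell = disk_zeros \<phi>"
    by (auto simp: shell_def)
  finally show ?thesis by (simp add: g_def)
qed

end

section \<open>Uniformly distributed point masses\<close>

lemma borel_measurable_cis [measurable (raw)]:
  "f \<in> borel_measurable M \<Longrightarrow> (\<lambda>x. cis (f x)) \<in> borel_measurable M"
  unfolding cis_conv_exp by measurable

locale random_phases = prob_space M for M :: "'a measure" +
  fixes \<theta> :: "nat \<Rightarrow> 'a \<Rightarrow> real" and c :: "nat \<Rightarrow> real"
  assumes indep: "indep_vars (\<lambda>_. borel) \<theta> UNIV"
    and uniform: "\<And>n. distr M lborel (\<theta> n) = uniform_measure lborel {0..<2 * pi}"
    and weights_nonneg: "\<And>n. 0 \<le> c n" and weights_sums: "c sums 1"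
begin

abbreviation \<zeta> :: "'a \<Rightarrow> nat \<Rightarrow> complex" where
  "\<zeta> \<omega> n \<equiv> cis (\<theta> n \<omega>)"

sublocale Herglotz: atomic_Herglotz c "\<zeta> \<omega>" for \<omega>
  using weights_nonneg weights_sums by unfold_locales auto

lemma measurable_\<theta> [measurable]: "\<theta> n \<in> borel_measurable M"
  using indep by (auto simp: indep_vars_def)

lemma measurable_H [measurable]: "(\<lambda>\<omega>. Herglotz.H \<omega> z) \<in> borel_measurable M"
  unfolding Herglotz.H_def by measurable

lemma prob_phase:
  assumes [measurable]: "Measurable.pred borel P"
  shows "emeasure M {\<omega> \<in> space M. P (\<theta> n \<omega>)}
    = emeasure (uniform_measure lborel {0..<2 * pi}) {t. P t}"
proof -
  have "emeasure (distr M lborel (\<theta> n)) {t. P t} = emeasure M (\<theta> n -` {t. P t} \<inter> space M)"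
    by (intro emeasure_distr) auto
  also have "\<theta> n -` {t. P t} \<inter> space M = {\<omega> \<in> space M. P (\<theta> n \<omega>)}"
    by auto
  finally show ?thesis by (simp add: uniform)
qed

lemma prob_near:
  assumes "0 \<le> r"
  shows "emeasure M {\<omega> \<in> space M. norm (\<zeta> \<omega> n - v) \<le> r} \<le> ennreal (4 * r)"
  using emeasure_uniform_cis_near[OF assms, of v] by (subst prob_phase) auto

text \<open>Anti-concentration: fix all angles except that of one point mass of positive weight. The remaining
angle alone makes the value \<open>1\<close> unlikely to be approached, by
\<open>emeasure_uniform_Cauchy_near\<close>; then integrate over the other angles, which are independent of
it.\<close>

lemma prob_H_near_1:
  assumes z: "1 / 2 \<le> norm z" "norm z < 1" and m: "0 < c m" and t: "0 \<le> t"
  shows "emeasure M {\<omega> \<in> space M. norm (Herglotz.H \<omega> z - 1) \<le> t} \<le> ennreal (32 * t / c m)"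
proof -
  define g where "g = (\<lambda>x. 2 * z * (complex_of_real (c m) / (cis x - z)))"
  \<comment> \<open>The contribution of the point masses other than \<open>m\<close>; it depends only on their angles.\<close>
  define W where "W = (\<lambda>y::nat \<Rightarrow> real. \<Sum>n. if n = m then 0 else 2 * z * (complex_of_real (c n) / (cis (y n) - z)))"
  define R where "R = (\<lambda>\<omega>. W (\<lambda>i\<in>UNIV - {m}. \<theta> i \<omega>))"
  have split: "Herglotz.H \<omega> z - 1 = g (\<theta> m \<omega>) + R \<omega>" for \<omega>
  proof -
    let ?f = "\<lambda>n. 2 * z * (complex_of_real (c n) / (\<zeta> \<omega> n - z))"
    have "(\<lambda>n. ?f n - (if n = m then ?f n else 0)) sums (Herglotz.H \<omega> z - 1 - ?f m)"
      by (intro sums_diff Herglotz.H_minus_1_sums sums_single z)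
    also have "(\<lambda>n. ?f n - (if n = m then ?f n else 0)) = (\<lambda>n. if n = m then 0 else
        2 * z * (complex_of_real (c n) / (cis ((\<lambda>i\<in>UNIV - {m}. \<theta> i \<omega>) n) - z)))"
      by auto
    finally show ?thesis
      unfolding R_def W_def g_def by (simp add: sums_iff)
  qed
  have W[measurable]: "W \<in> borel_measurable (PiM (UNIV - {m}) (\<lambda>_. borel))"
    unfolding W_def
  proof (rule borel_measurable_suminf)
    fix n
    show "(\<lambda>y. if n = m then 0 else 2 * z * (complex_of_real (c n) / (cis (y n) - z)))
        \<in> borel_measurable (PiM (UNIV - {m}) (\<lambda>_. borel))"
      by (cases "n = m") auto
  qed
  have g[measurable]: "g \<in> borel_measurable borel"
    unfolding g_def by measurable
  have "indep_var (PiM {m} (\<lambda>_. borel)) (\<lambda>\<omega>. \<lambda>i\<in>{m}. \<theta> i \<omega>)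
      (PiM (UNIV - {m}) (\<lambda>_. borel)) (\<lambda>\<omega>. \<lambda>i\<in>UNIV - {m}. \<theta> i \<omega>)"
    by (rule indep_var_restrict[OF indep]) auto
  then have "indep_var borel ((\<lambda>x. g (x m)) \<circ> (\<lambda>\<omega>. \<lambda>i\<in>{m}. \<theta> i \<omega>)) borel (W \<circ> (\<lambda>\<omega>. \<lambda>i\<in>UNIV - {m}. \<theta> i \<omega>))"
    by (rule indep_var_compose) measurable
  then have ind: "indep_var borel (\<lambda>\<omega>. g (\<theta> m \<omega>)) borel R"
    by (simp add: o_def R_def[abs_def])
  then have [measurable]: "R \<in> borel_measurable M"
    and prod: "distr M borel (\<lambda>\<omega>. g (\<theta> m \<omega>)) \<Otimes>\<^sub>M distr M borel R
      = distr M (borel \<Otimes>\<^sub>M borel) (\<lambda>\<omega>. (g (\<theta> m \<omega>), R \<omega>))"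
    unfolding indep_var_distribution_eq by auto
  interpret X: prob_space "distr M borel (\<lambda>\<omega>. g (\<theta> m \<omega>))" by (rule prob_space_distr) simp
  interpret Y: prob_space "distr M borel R" by (rule prob_space_distr) simp
  interpret XY: pair_prob_space "distr M borel (\<lambda>\<omega>. g (\<theta> m \<omega>))" "distr M borel R" ..
  define E where "E = {x :: complex \<times> complex. norm (fst x + snd x) \<le> t}"
  have "E \<in> sets borel"
    unfolding E_def by (intro borel_closed closed_Collect_le continuous_intros)
  then have E: "E \<in> sets (borel \<Otimes>\<^sub>M borel)"
    by (subst borel_prod)
  have "emeasure M {\<omega> \<in> space M. norm (Herglotz.H \<omega> z - 1) \<le> t}
      = emeasure (distr M (borel \<Otimes>\<^sub>M borel) (\<lambda>\<omega>. (g (\<theta> m \<omega>), R \<omega>))) E"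
    using E by (subst emeasure_distr) (auto simp: E_def split intro!: arg_cong[where f = "emeasure M"])
  also have "\<dots> = (\<integral>\<^sup>+ w. emeasure (distr M borel (\<lambda>\<omega>. g (\<theta> m \<omega>))) ((\<lambda>x. (x, w)) -` E) \<partial>distr M borel R)"
    unfolding prod[symmetric] using E by (intro XY.emeasure_pair_measure_alt2) (simp cong: sets_pair_measure_cong)
  also have "\<dots> \<le> (\<integral>\<^sup>+ w. ennreal (32 * t / c m) \<partial>distr M borel R)"
  proof (intro nn_integral_mono)
    fix w :: complex
    have "{v. norm (v + w) \<le> t} \<in> sets borel"
      by (intro borel_closed closed_Collect_le continuous_intros)
    then have "emeasure (distr M borel (\<lambda>\<omega>. g (\<theta> m \<omega>))) ((\<lambda>x. (x, w)) -` E)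
        = emeasure M {\<omega> \<in> space M. norm (g (\<theta> m \<omega>) + w) \<le> t}"
      by (subst emeasure_distr) (auto simp: E_def vimage_def intro!: arg_cong[where f = "emeasure M"])
    also have "\<dots> = emeasure (uniform_measure lborel {0..<2 * pi}) {x. norm (g x + w) \<le> t}"
      by (rule prob_phase) measurable
    also have "\<dots> \<le> ennreal (32 * t / c m)"
      unfolding g_def by (rule emeasure_uniform_Cauchy_near[OF z m t])
    finally show "emeasure (distr M borel (\<lambda>\<omega>. g (\<theta> m \<omega>))) ((\<lambda>x. (x, w)) -` E) \<le> ennreal (32 * t / c m)" .
  qed
  also have "\<dots> = ennreal (32 * t / c m)"
    using Y.emeasure_space_1 by simp
  finally show ?thesis .
qed

text \<open>With \<open>\<delta> = 1 - \<bar>z\<bar>\<close>, the Poisson kernel is at most \<open>2 * \<delta> / D\<^sup>2\<close>, where \<open>D\<close> is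
the distance from \<open>\<zeta>\<close> to \<open>z\<close>. The event that \<open>D\<close> is about \<open>2 ^ i * \<delta>\<close> has probability at most of
order \<open>2 ^ i * \<delta>\<close>, so the scale \<open>i\<close> contributes at most \<open>\<delta> powr (1 - p) * 2 powr ((1 - 2 * p) * i)\<close> up to a
constant. The geometric series over \<open>i\<close> converges because \<open>p > 1 / 2\<close>.\<close>

lemma Poisson_powr_moment:
  assumes z: "norm z < 1" and p: "1 / 2 < p" "p \<le> 1"
  shows "(\<integral>\<^sup>+ \<omega>. ennreal (((1 - (norm z)\<^sup>2) / (norm (\<zeta> \<omega> n - z))\<^sup>2) powr p) \<partial>M)
    \<le> ennreal (16 / (1 - 2 powr (1 - 2 * p)) * (1 - norm z) powr (1 - p))"
proof -
  define \<delta> where "\<delta> = 1 - norm z"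
  have \<delta>: "0 < \<delta>" using z by (simp add: \<delta>_def)
  define b where "b = 2 powr (- 2 * p)"
  have b: "0 < b" "2 * b = 2 powr (1 - 2 * p)" "2 * b < 1"
    using p powr_add[of 2 1 "- 2 * p"] powr_less_mono[of "1 - 2 * p" 0 2] by (auto simp: b_def)
  define a where "a = (\<lambda>i. 2 * \<delta> powr (- p) * b ^ i)"
  have a: "0 \<le> a i" for i using b by (simp add: a_def)
  define S where "S = (\<lambda>i. {\<omega> \<in> space M. norm (\<zeta> \<omega> n - z) \<le> 2 ^ (i + 1) * \<delta>})"
  have [measurable]: "S i \<in> sets M" for i unfolding S_def by measurable
  have pointwise: "ennreal (((1 - (norm z)\<^sup>2) / (norm (\<zeta> \<omega> n - z))\<^sup>2) powr p)
      \<le> (\<Sum>i. ennreal (a i) * indicator (S i) \<omega>)" if \<omega>: "\<omega> \<in> space M" for \<omega>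
  proof -
    define D where "D = norm (\<zeta> \<omega> n - z)"
    have D: "\<delta> \<le> D"
      using norm_triangle_ineq2[of "\<zeta> \<omega> n" z] by (simp add: D_def \<delta>_def)
    have ex: "\<exists>i. D < 2 ^ (i + 1) * \<delta>"
    proof -
      obtain i :: nat where "D / \<delta> < 2 ^ i" using real_arch_pow[of 2 "D / \<delta>"] by auto
      then have "D < 2 ^ i * \<delta>" using \<delta> by (simp add: field_simps)
      also have "\<dots> \<le> 2 ^ (i + 1) * \<delta>" using \<delta> by simp
      finally show ?thesis by blast
    qed
    \<comment> \<open>The scale of the distance: \<open>2 ^ i * \<delta> \<le> D < 2 ^ (i + 1) * \<delta>\<close>.\<close>
    define i where "i = (LEAST i. D < 2 ^ (i + 1) * \<delta>)"
    have i: "D < 2 ^ (i + 1) * \<delta>" using LeastI_ex[OF ex] by (simp add: i_def)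
    have i': "2 ^ i * \<delta> \<le> D"
    proof (cases i)
      case (Suc k)
      then have "\<not> D < 2 ^ (k + 1) * \<delta>"
        using not_less_Least[of k "\<lambda>i. D < 2 ^ (i + 1) * \<delta>"] by (simp add: i_def)
      then show ?thesis using Suc by simp
    qed (use D in simp)
    have "(1 - (norm z)\<^sup>2) / D\<^sup>2 \<le> 2 * \<delta> / (2 ^ i * \<delta>)\<^sup>2"
    proof (intro frac_le power_mono)
      have "1 - (norm z)\<^sup>2 = (1 + norm z) * \<delta>" by (simp add: \<delta>_def power2_eq_square algebra_simps)
      also have "\<dots> \<le> 2 * \<delta>" using z \<delta> by (intro mult_right_mono) auto
      finally show "1 - (norm z)\<^sup>2 \<le> 2 * \<delta>" .
    qed (use i' \<delta> in auto)
    also have "\<dots> = 2 * inverse \<delta> * (inverse 4) ^ i"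
    proof -
      have "(2 ^ i)\<^sup>2 = (4 :: real) ^ i" by (simp add: power2_eq_square flip: power_mult_distrib)
      then show ?thesis using \<delta>
        by (simp add: power_mult_distrib field_simps power2_eq_square flip: power_inverse)
    qed
    finally have "((1 - (norm z)\<^sup>2) / D\<^sup>2) powr p \<le> (2 * inverse \<delta> * (inverse 4) ^ i) powr p"
      using p z by (intro powr_mono2) (auto simp: abs_square_le_1)
    also have "\<dots> = 2 powr p * \<delta> powr (- p) * ((inverse 4) ^ i) powr p"
      using \<delta> by (simp add: powr_mult powr_minus inverse_powr)
    also have "((inverse 4 :: real) ^ i) powr p = b ^ i"
    proof -
      have "(inverse 4 :: real) = 2 powr - 2" by (simp add: powr_minus)
      then have "(inverse 4 :: real) powr p = b" by (simp only: powr_powr b_def)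
      then show ?thesis using power_powr[of "inverse 4" i p] by simp
    qed
    also have "2 powr p * \<delta> powr (- p) * b ^ i \<le> a i"
      unfolding a_def using p b powr_mono[of p 1 2] by (intro mult_right_mono) auto
    finally have "ennreal (((1 - (norm z)\<^sup>2) / D\<^sup>2) powr p) \<le> ennreal (a i) * indicator (S i) \<omega>"
      using i \<omega> by (simp add: S_def D_def ennreal_leI)
    also have "\<dots> \<le> (\<Sum>i. ennreal (a i) * indicator (S i) \<omega>)"
    proof -
      have "F i \<le> suminf F" for F :: "nat \<Rightarrow> ennreal"
        using sum_le_suminf[of F "{i}"] by simp
      then show ?thesis .
    qed
    finally show ?thesis by (simp add: D_def)
  qed
  have "(\<integral>\<^sup>+ \<omega>. ennreal (((1 - (norm z)\<^sup>2) / (norm (\<zeta> \<omega> n - z))\<^sup>2) powr p) \<partial>M)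
      \<le> (\<integral>\<^sup>+ \<omega>. (\<Sum>i. ennreal (a i) * indicator (S i) \<omega>) \<partial>M)"
    by (intro nn_integral_mono pointwise)
  also have "\<dots> = (\<Sum>i. ennreal (a i) * emeasure M (S i))"
    by (simp add: nn_integral_suminf nn_integral_cmult)
  also have "\<dots> \<le> (\<Sum>i. ennreal (16 * \<delta> powr (1 - p) * (2 * b) ^ i))"
  proof (intro suminf_le)
    fix i
    have "ennreal (a i) * emeasure M (S i) \<le> ennreal (a i) * ennreal (4 * (2 ^ (i + 1) * \<delta>))"
      unfolding S_def using \<delta> by (intro mult_left_mono prob_near) auto
    also have "\<dots> = ennreal (a i * (4 * (2 ^ (i + 1) * \<delta>)))"
      using a by (simp add: ennreal_mult')
    also have "a i * (4 * (2 ^ (i + 1) * \<delta>)) = 16 * (\<delta> powr (- p) * \<delta>) * (2 * b) ^ i"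
      by (simp add: a_def power_mult_distrib)
    also have "\<delta> powr (- p) * \<delta> = \<delta> powr (1 - p)"
      using \<delta> powr_add[of \<delta> "- p" 1] by simp
    finally show "ennreal (a i) * emeasure M (S i) \<le> ennreal (16 * \<delta> powr (1 - p) * (2 * b) ^ i)" .
  qed auto
  also have "\<dots> = ennreal (\<Sum>i. 16 * \<delta> powr (1 - p) * (2 * b) ^ i)"
    using b by (intro suminf_ennreal2) (auto intro!: summable_mult summable_geometric)
  also have "(\<Sum>i. 16 * \<delta> powr (1 - p) * (2 * b) ^ i) = 16 * \<delta> powr (1 - p) * (1 / (1 - 2 * b))"
    using b by (subst suminf_mult) (auto simp: suminf_geometric intro!: summable_geometric)
  also have "\<dots> = 16 / (1 - 2 powr (1 - 2 * p)) * (1 - norm z) powr (1 - p)"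
    by (simp add: \<delta>_def b(2))
  finally show ?thesis .
qed

text \<open>The mean of \<open>Re H\<close> is \<open>1\<close> at every point; only powers below the first become small
near the circle, and they are subadditive, so that the weights enter through the sum of their
\<open>p\<close>-th powers.\<close>

lemma Re_H_powr_moment:
  assumes z: "norm z < 1" and p: "1 / 2 < p" "p \<le> 1" and c: "summable (\<lambda>n. c n powr p)"
  shows "(\<integral>\<^sup>+ \<omega>. ennreal (Re (Herglotz.H \<omega> z) powr p) \<partial>M)
    \<le> ennreal ((\<Sum>n. c n powr p) * (16 / (1 - 2 powr (1 - 2 * p))) * (1 - norm z) powr (1 - p))"
proof -
  define P where "P = (\<lambda>\<omega> n. (1 - (norm z)\<^sup>2) / (norm (\<zeta> \<omega> n - z))\<^sup>2)"
  define K where "K = 16 / (1 - 2 powr (1 - 2 * p)) * (1 - norm z) powr (1 - p)"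
  have K: "0 \<le> K"
    using p powr_mono[of "1 - 2 * p" 0 2] by (simp add: K_def)
  have P: "0 \<le> P \<omega> n" "P \<omega> n \<le> 2 / (1 - norm z)" for \<omega> n
    using z Herglotz_kernel_bound(1)[of "\<zeta> \<omega> n" z] Re_Herglotz_kernel[of "\<zeta> \<omega> n" z]
      complex_Re_le_cmod[of "(\<zeta> \<omega> n + z) / (\<zeta> \<omega> n - z)"]
    by (auto simp: P_def abs_square_le_1)
  have [measurable]: "(\<lambda>\<omega>. P \<omega> n) \<in> borel_measurable M" for n
    unfolding P_def by measurable
  have "Re (Herglotz.H \<omega> z) powr p \<le> (\<Sum>n. c n powr p * P \<omega> n powr p)"
    and sm: "summable (\<lambda>n. c n powr p * P \<omega> n powr p)" for \<omega>
  proof -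
    have s: "(\<lambda>n. c n * P \<omega> n) sums Re (Herglotz.H \<omega> z)"
      unfolding P_def by (rule Herglotz.Re_H_sums[OF z])
    show sm: "summable (\<lambda>n. c n powr p * P \<omega> n powr p)"
    proof (rule summable_comparison_test'[OF summable_mult2[OF c]])
      fix n
      show "norm (c n powr p * P \<omega> n powr p) \<le> c n powr p * (2 / (1 - norm z)) powr p"
        using P[of \<omega> n] p by (simp add: mult_left_mono powr_mono2)
    qed
    have "(\<Sum>n. c n * P \<omega> n) powr p \<le> (\<Sum>n. (c n * P \<omega> n) powr p)"
      using p P weights_nonneg sm
      by (intro powr_suminf_le sums_summable[OF s]) (auto simp: powr_mult)
    then show "Re (Herglotz.H \<omega> z) powr p \<le> (\<Sum>n. c n powr p * P \<omega> n powr p)"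
      using P weights_nonneg sums_unique[OF s] by (simp add: powr_mult)
  qed
  then have "ennreal (Re (Herglotz.H \<omega> z) powr p) \<le> (\<Sum>n. ennreal (c n powr p) * ennreal (P \<omega> n powr p))" for \<omega>
    by (simp add: suminf_ennreal2[OF _ sm] ennreal_leI flip: ennreal_mult)
  then have "(\<integral>\<^sup>+ \<omega>. ennreal (Re (Herglotz.H \<omega> z) powr p) \<partial>M)
      \<le> (\<integral>\<^sup>+ \<omega>. (\<Sum>n. ennreal (c n powr p) * ennreal (P \<omega> n powr p)) \<partial>M)"
    by (intro nn_integral_mono)
  also have "\<dots> = (\<Sum>n. ennreal (c n powr p) * (\<integral>\<^sup>+ \<omega>. ennreal (P \<omega> n powr p) \<partial>M))"
    by (simp add: nn_integral_suminf nn_integral_cmult)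
  also have "\<dots> \<le> (\<Sum>n. ennreal (c n powr p) * ennreal K)"
    unfolding P_def K_def by (intro suminf_le mult_left_mono Poisson_powr_moment z p) auto
  also have "\<dots> = ennreal (\<Sum>n. c n powr p * K)"
    using K by (subst suminf_ennreal2[symmetric]) (auto simp: ennreal_mult intro!: summable_mult2 c)
  also have "(\<Sum>n. c n powr p * K) = (\<Sum>n. c n powr p) * K"
    by (rule suminf_mult2[OF c, symmetric])
  finally show ?thesis by (simp add: K_def mult.assoc)
qed

end

section \<open>Almost sure behaviour on the grid\<close>

context random_phases
begin

text \<open>Level \<open>j\<close> has about \<open>1 / grid_gap j\<close> points, and at each of them the bound fails with
probability at most of order \<open>grid_gap j ^ 4\<close>, by \<open>prob_H_near_1\<close>. The resulting bounds of order
\<open>grid_gap j ^ 3\<close> for the levels are summable, and the Borel-Cantelli lemma applies.\<close>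

lemma AE_H_far_from_1_on_grid:
  "AE \<omega> in M. \<exists>J. \<forall>j\<ge>J. \<forall>k<grid_size j.
    grid_gap j ^ 4 \<le> norm (Herglotz.H \<omega> (grid_point j k) - 1)"
proof -
  obtain m where m: "0 < c m"
    using Herglotz.c_pos_ex ..
  define S where "S = (\<lambda>j k. {\<omega> \<in> space M. norm (Herglotz.H \<omega> (grid_point j k) - 1) \<le> grid_gap j ^ 4})"
  have [measurable]: "S j k \<in> sets M" for j k
    unfolding S_def by measurable
  define A where "A = (\<lambda>j. \<Union>k<grid_size j. S j k)"
  have A[measurable]: "A j \<in> sets M" for j
    unfolding A_def by measurable
  have prob_S: "prob (S j k) \<le> 32 * grid_gap j ^ 4 / c m" for j k
  proof -
    have "emeasure M (S j k) \<le> ennreal (32 * grid_gap j ^ 4 / c m)"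
      unfolding S_def using grid_gap_pos[of j]
      by (intro prob_H_near_1 norm_grid_point_ge norm_grid_point_less m) auto
    then show ?thesis
      using m grid_gap_pos[of j] by (simp add: emeasure_eq_measure)
  qed
  have "prob (A j) \<le> 2080 / c m * grid_gap j powr 3" for j
  proof -
    have "prob (A j) \<le> (\<Sum>k<grid_size j. prob (S j k))"
      unfolding A_def by (intro finite_measure_subadditive_finite) auto
    also have "\<dots> \<le> (\<Sum>k<grid_size j. 32 * grid_gap j ^ 4 / c m)"
      by (intro sum_mono prob_S)
    also have "\<dots> = (grid_size j * grid_gap j) * (32 / c m * grid_gap j ^ 3)"
      by (simp add: power_numeral_reduce)
    also have "\<dots> \<le> 65 * (32 / c m * grid_gap j ^ 3)"
      using m grid_gap_pos[of j] by (intro mult_right_mono grid_size_bounds(2)) auto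
    also have "\<dots> = 2080 / c m * grid_gap j powr 3"
      using grid_gap_pos[of j] by (simp add: powr_numeral)
    finally show ?thesis .
  qed
  then have "summable (\<lambda>j. prob (A j))"
    by (intro summable_comparison_test'[OF summable_mult[OF summable_grid_gap_powr[of 3], of "2080 / c m"]]) auto
  then have "AE \<omega> in M. eventually (\<lambda>j. \<omega> \<in> space M - A j) sequentially"
    by (intro borel_cantelli_AE1) (auto simp: emeasure_eq_measure)
  then show ?thesis
  proof eventually_elim
    case (elim \<omega>)
    then obtain J where J: "\<And>j. J \<le> j \<Longrightarrow> \<omega> \<in> space M - A j"
      unfolding eventually_sequentially by blast
    have "grid_gap j ^ 4 \<le> norm (Herglotz.H \<omega> (grid_point j k) - 1)" if "J \<le> j" "k < grid_size j" for j k
      using J[OF that(1)] that(2) by (force simp: A_def S_def)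
    then show ?case by blast
  qed
qed

text \<open>The expectation of the sum over level \<open>j\<close> is at most a constant times the number of points, times
\<open>grid_gap j powr s\<close>, times \<open>grid_gap j powr (1 - p)\<close> from \<open>Re_H_powr_moment\<close>. Up to the logarithm
this is \<open>grid_gap j powr (s - p)\<close>, so the whole sum has finite expectation.\<close>

lemma AE_grid_summable:
  assumes p: "1 / 2 < p" "p \<le> 1" and ps: "p < s" and c: "summable (\<lambda>n. c n powr p)"
  shows "AE \<omega> in M. summable (\<lambda>j. \<Sum>k<grid_size j.
    grid_gap j powr s * (1 + ln (1 / grid_gap j)) * Re (Herglotz.H \<omega> (grid_point j k)) powr p)"
proof -
  define K where "K = (\<Sum>n. c n powr p) * (16 / (1 - 2 powr (1 - 2 * p)))"
  have K: "0 \<le> K"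
    unfolding K_def using p powr_mono[of "1 - 2 * p" 0 2] c
    by (intro mult_nonneg_nonneg suminf_nonneg) auto
  define L where "L = (\<lambda>j. grid_gap j powr s * (1 + ln (1 / grid_gap j)))"
  have L: "0 \<le> L j" for j
    using ln_grid_gap_nonneg[of j] by (simp add: L_def)
  define h where "h = (\<lambda>j k \<omega>. Re (Herglotz.H \<omega> (grid_point j k)) powr p)"
  have [measurable]: "h j k \<in> borel_measurable M" for j k
    unfolding h_def by measurable
  define f where "f = (\<lambda>j \<omega>. \<Sum>k<grid_size j. L j * h j k \<omega>)"
  have f0: "0 \<le> f j \<omega>" for j \<omega>
    using L by (auto simp: f_def h_def intro!: sum_nonneg)
  define e where "e = s - p"
  have e: "0 < e" using ps by (simp add: e_def)
  have bound: "(\<integral>\<^sup>+ \<omega>. ennreal (f j \<omega>) \<partial>M)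
      \<le> ennreal (65 * K * ((1 + ln (1 / grid_gap j)) * grid_gap j powr e))" for j
  proof -
    define \<delta> where "\<delta> = grid_gap j"
    have \<delta>: "0 < \<delta>" using grid_gap_pos by (simp add: \<delta>_def)
    have "(\<integral>\<^sup>+ \<omega>. ennreal (f j \<omega>) \<partial>M)
        = (\<Sum>k<grid_size j. ennreal (L j) * (\<integral>\<^sup>+ \<omega>. ennreal (h j k \<omega>) \<partial>M))"
    proof -
      have "ennreal (f j \<omega>) = (\<Sum>k<grid_size j. ennreal (L j) * ennreal (h j k \<omega>))" for \<omega>
        unfolding f_def using L[of j]
        by (subst sum_ennreal[symmetric]) (auto simp: ennreal_mult h_def)
      then show ?thesis
        by (simp add: nn_integral_sum nn_integral_cmult)
    qed
    also have "\<dots> \<le> (\<Sum>k<grid_size j. ennreal (L j) * ennreal (K * \<delta> powr (1 - p)))"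
    proof (intro sum_mono mult_left_mono)
      fix k
      show "(\<integral>\<^sup>+ \<omega>. ennreal (h j k \<omega>) \<partial>M) \<le> ennreal (K * \<delta> powr (1 - p))"
        using Re_H_powr_moment[OF norm_grid_point_less p c, of j k]
        by (simp add: h_def K_def norm_grid_point \<delta>_def)
    qed auto
    also have "\<dots> = ennreal (grid_size j * (L j * (K * \<delta> powr (1 - p))))"
      using L K by (simp add: ennreal_mult ennreal_of_nat_eq_real_of_nat)
    also have "grid_size j * (L j * (K * \<delta> powr (1 - p)))
        = grid_size j * (\<delta> powr 1 * \<delta> powr e) * K * (1 + ln (1 / \<delta>))"
    proof -
      have "\<delta> powr s * \<delta> powr (1 - p) = \<delta> powr 1 * \<delta> powr e"
        unfolding powr_add[symmetric] by (simp add: e_def algebra_simps)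
      then show ?thesis
        by (simp add: L_def \<delta>_def[symmetric] mult_ac)
    qed
    also have "\<dots> = (grid_size j * \<delta>) * (K * ((1 + ln (1 / \<delta>)) * \<delta> powr e))"
      using \<delta> by (simp add: mult_ac)
    also have "\<dots> \<le> 65 * (K * ((1 + ln (1 / \<delta>)) * \<delta> powr e))"
      unfolding \<delta>_def using K ln_grid_gap_nonneg[of j] by (intro mult_right_mono grid_size_bounds(2)) auto
    finally show ?thesis
      by (simp add: \<delta>_def mult_ac ennreal_leI)
  qed
  have "(\<integral>\<^sup>+ \<omega>. (\<Sum>j. ennreal (f j \<omega>)) \<partial>M) = (\<Sum>j. (\<integral>\<^sup>+ \<omega>. ennreal (f j \<omega>) \<partial>M))"
    unfolding f_def by (intro nn_integral_suminf) measurable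
  also have "\<dots> \<le> (\<Sum>j. ennreal (65 * K * ((1 + ln (1 / grid_gap j)) * grid_gap j powr e)))"
    by (intro suminf_le bound) auto
  also have "\<dots> = ennreal (\<Sum>j. 65 * K * ((1 + ln (1 / grid_gap j)) * grid_gap j powr e))"
    using K ln_grid_gap_nonneg
    by (intro suminf_ennreal2 summable_mult summable_ln_grid_gap_powr e) (auto intro!: mult_nonneg_nonneg add_nonneg_nonneg)
  finally have "(\<integral>\<^sup>+ \<omega>. (\<Sum>j. ennreal (f j \<omega>)) \<partial>M) \<noteq> \<infinity>"
    by (auto simp: top_unique)
  then have "AE \<omega> in M. (\<Sum>j. ennreal (f j \<omega>)) \<noteq> \<infinity>"
    by (intro nn_integral_PInf_AE) (auto simp: f_def)
  then show ?thesis
  proof eventually_elim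
    case (elim \<omega>)
    then have "summable (\<lambda>j. f j \<omega>)"
      using f0 by (intro summable_suminf_not_top) auto
    then show ?case
      by (simp add: f_def L_def h_def)
  qed
qed

end

theorem theorem1p4:
  fixes M :: "'a measure" and \<theta> :: "nat \<Rightarrow> 'a \<Rightarrow> real"
    and c :: "nat \<Rightarrow> real" and \<alpha> \<epsilon> :: real
  assumes "prob_space M"
    and "\<And>n. c n \<ge> 0"
    and "c sums 1"
    and "prob_space.indep_vars M (\<lambda>_. borel) \<theta> UNIV"
    and "\<And>n. distr M lborel (\<theta> n) = uniform_measure lborel {0..<2 * pi}"
    and "1 / 2 \<le> \<alpha>" and "\<alpha> < 1"
    and "summable (\<lambda>n. c n powr \<alpha>)"
    and "\<epsilon> > 0"
  shows "AE \<omega> in M.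
    (\<lambda>(w, j). (1 - norm w) powr (\<alpha> + \<epsilon>)) summable_on
      disk_zeros (inner_of_measure (atomic_measure c (\<lambda>n. cis (\<theta> n \<omega>))))"
proof -
  interpret prob_space M by fact
  interpret random_phases M \<theta> c
    using assms by unfold_locales auto
  \<comment> \<open>Strictly above \<open>\<alpha>\<close>, since the moment estimate needs \<open>p > 1 / 2\<close>; strictly below \<open>\<alpha> + \<epsilon>\<close>, for the sum over the levels.\<close>
  define p where "p = min ((\<alpha> + 1) / 2) (\<alpha> + \<epsilon> / 2)"
  have p: "1 / 2 < p" "p \<le> 1" "\<alpha> < p" "p < \<alpha> + \<epsilon>"
    using assms by (auto simp: p_def min_def)
  have c1: "c n \<le> 1" for n
    using sum_le_suminf[of c "{n}"] assms(2,3) by (simp add: sums_iff)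
  have "summable (\<lambda>n. c n powr p)"
    using p assms(2) c1
    by (intro summable_comparison_test'[OF assms(8)]) (auto intro: powr_mono')
  then have "AE \<omega> in M. summable (\<lambda>j. \<Sum>k<grid_size j. grid_gap j powr (\<alpha> + \<epsilon>) *
      (1 + ln (1 / grid_gap j)) * Re (Herglotz.H \<omega> (grid_point j k)) powr p)"
    using p by (intro AE_grid_summable)
  with AE_H_far_from_1_on_grid show ?thesis
  proof eventually_elim
    case (elim \<omega>)
    then obtain J where
      "\<And>j k. J \<le> j \<Longrightarrow> k < grid_size j \<Longrightarrow> grid_gap j ^ 4 \<le> norm (Herglotz.H \<omega> (grid_point j k) - 1)"
      by blast
    with elim(2) p assms(6,9) show ?case
      by (intro Herglotz.zeros_summable_if_grid_summable[of p _ J]) auto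
  qed
qed

end
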